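(* Let $p$ be an odd prime and $k$ an algebraically closed field of characteristic $p$. Let $q$ be a prime power such that $p$ exactly divides $q-1$ and $T = \mathrm{PSL}_2(q)$ is simple, and let $T_1\le T$ be a dihedral subgroup of order $2p$ such that some left coset $tT_1$ ($t\in T$) contains no element of order prime to $p$. Let $L$ be a cyclic group of order $2$ and $m = [T:T_1]$. Let $G = L\wr T = N\rtimes T$ be the permutational wreath product, with $N = L_1\times\cdots\times L_m$ (of order $2^m$) indexed by the left cosets of $T_1$ in $T$ ($L_1$ corresponding to $T_1$) and $T$ permuting the factors as it permutes these cosets. Let $K = NT_1$ and let $W$ be the $1$-dimensional $kK$-module on which $L_1$ acts by the nontrivial character and $L_2\times\cdots\times L_m$ and $T_1$ act trivially. Set $V = \mathrm{Ind}_K^G(W)$. Then: (1) $V$ is an absolutely irreducible $kG$-module of dimension $m$, which is prime to $p$; (2) $H^1(G,k) = 0$, $p\nmid\dim V$, and $H^1(G,V\otimes V^* ) = 0$; and (3) $(G,V)$ is not adequate (indeed, $\mathrm{End}_k(V)$ is not spanned by the images of elements of $G$ acting semisimply on $V$).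
   Context: For an absolutely irreducible representation $\rho:G\to\mathrm{GL}(V)$ over $k$ of characteristic $p$, $(G,V)$ is adequate if: (1) $H^1(G,k)=0$; (2) $p\nmid\dim V$; (3) $H^1(G,V\otimes V^* )=0$; (4) $\mathrm{End}_k(V)$ is spanned by the elements $\rho(g)$ with $\rho(g)$ semisimple. *)

theory Defs
  imports "HOL-Algebra.Coset" "HOL-Algebra.SimpleGroups" "HOL-Algebra.Elementary_Groups" "HOL-Algebra.Multiplicative_Group"
          "HOL-Computational_Algebra.Polynomial" "HOL-Library.Function_Algebras"
begin

text \<open>2x2 matrices (a,b,c,d) = [[a,b],[c,d]].\<close>

definition SL2 :: "('f::field \<times> 'f \<times> 'f \<times> 'f) monoid" where
  "SL2 = \<lparr> carrier = {(a,b,c,d). a*d - b*c = 1},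
           monoid.mult = (\<lambda>(a,b,c,d) (a',b',c',d').
                     (a*a' + b*c', a*b' + b*d', c*a' + d*c', c*b' + d*d')),
           one = (1,0,0,1) \<rparr>"

definition PSL2 :: "('f::field \<times> 'f \<times> 'f \<times> 'f) set monoid" where
  "PSL2 = SL2 Mod {(1,0,0,1), (-1,0,0,-1)}"

definition dihedral_subgroup :: "('a,'b) monoid_scheme \<Rightarrow> 'a set \<Rightarrow> nat \<Rightarrow> bool" where
  "dihedral_subgroup G H n \<longleftrightarrow> subgroup H G \<and> card H = 2 * n \<and>
     (\<exists>r\<in>H. \<exists>s\<in>H. group.ord G r = n \<and> group.ord G s = 2 \<and>
        s \<otimes>\<^bsub>G\<^esub> r \<otimes>\<^bsub>G\<^esub> inv\<^bsub>G\<^esub> s = inv\<^bsub>G\<^esub> r \<and>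
        generate G {r, s} = H)"

definition lcosets_of :: "('a,'b) monoid_scheme \<Rightarrow> 'a set \<Rightarrow> 'a set set" where
  "lcosets_of T T1 = {t <#\<^bsub>T\<^esub> T1 | t. t \<in> carrier T}"

text \<open>Elements (f,t): f \<in> N = functions from the cosets to L, t \<in> T.
  T acts on N by (t.f)(C) = f(t^{-1} C), i.e. t moves factor L_C to L_{tC}.\<close>

definition wreath :: "('l,'c) monoid_scheme \<Rightarrow> ('a,'b) monoid_scheme \<Rightarrow> 'a set
                       \<Rightarrow> (('a set \<Rightarrow> 'l) \<times> 'a) monoid" where
  "wreath L T T1 = \<lparr> carrier = {(f,t). f \<in> lcosets_of T T1 \<rightarrow>\<^sub>E carrier L \<and> t \<in> carrier T},
     monoid.mult = (\<lambda>(f,t) (f',t'). (\<lambda>C\<in>lcosets_of T T1. f C \<otimes>\<^bsub>L\<^esub> f' (inv\<^bsub>T\<^esub> t <#\<^bsub>T\<^esub> C),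
                               t \<otimes>\<^bsub>T\<^esub> t')),
     one = (\<lambda>C\<in>lcosets_of T T1. \<one>\<^bsub>L\<^esub>, \<one>\<^bsub>T\<^esub>) \<rparr>"

definition wreath_K :: "('l,'c) monoid_scheme \<Rightarrow> ('a,'b) monoid_scheme \<Rightarrow> 'a set
                       \<Rightarrow> (('a set \<Rightarrow> 'l) \<times> 'a) set" where
  "wreath_K L T T1 = {(f,t) \<in> carrier (wreath L T T1). t \<in> T1}"

text \<open>The character of K on W: L_1 (the factor at the coset T1) acts by the
  nontrivial character of the group L of order 2, the other factors and T1 trivially.\<close>
definition W_char :: "('l,'c) monoid_scheme \<Rightarrow> 'a set \<Rightarrow> ('a set \<Rightarrow> 'l) \<times> 'a \<Rightarrow> 'k::field" where
  "W_char L T1 x = (if fst x T1 = \<one>\<^bsub>L\<^esub> then 1 else -1)"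

text \<open>Ind_K^G(W) for W one-dimensional with character psi, realized as
  {phi : G \<rightarrow> k | phi(h x) = psi(h) phi(x) for h \<in> K}, with G acting by
  right translation.  Functions are taken to be 0 outside carrier G.\<close>

definition induced_space :: "('g,'b) monoid_scheme \<Rightarrow> 'g set \<Rightarrow> ('g \<Rightarrow> 'k::field) \<Rightarrow> ('g \<Rightarrow> 'k) set" where
  "induced_space G K psi = {phi. (\<forall>x. x \<notin> carrier G \<longrightarrow> phi x = 0) \<and>
      (\<forall>h\<in>K. \<forall>x\<in>carrier G. phi (h \<otimes>\<^bsub>G\<^esub> x) = psi h * phi x)}"

definition induced_action :: "('g,'b) monoid_scheme \<Rightarrow> 'g \<Rightarrow> ('g \<Rightarrow> 'k::field) \<Rightarrow> ('g \<Rightarrow> 'k)" where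
  "induced_action G g phi = (\<lambda>x. if x \<in> carrier G then phi (x \<otimes>\<^bsub>G\<^esub> g) else 0)"

definition fscale :: "'k::field \<Rightarrow> ('g \<Rightarrow> 'k) \<Rightarrow> ('g \<Rightarrow> 'k)" where
  "fscale c phi = (\<lambda>x. c * phi x)"

definition is_linear_on :: "('k \<Rightarrow> 'v \<Rightarrow> 'v) \<Rightarrow> 'v set \<Rightarrow> ('v \<Rightarrow> 'v::ab_group_add) \<Rightarrow> bool" where
  "is_linear_on sc V A \<longleftrightarrow> (\<forall>x\<in>V. A x \<in> V) \<and>
     (\<forall>x\<in>V. \<forall>y\<in>V. A (x + y) = A x + A y) \<and> (\<forall>c. \<forall>x\<in>V. A (sc c x) = sc c (A x))"

definition is_rep :: "('k::field \<Rightarrow> 'v \<Rightarrow> 'v::ab_group_add) \<Rightarrow> ('g,'b) monoid_scheme \<Rightarrow> 'v set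
                     \<Rightarrow> ('g \<Rightarrow> 'v \<Rightarrow> 'v) \<Rightarrow> bool" where
  "is_rep sc G V rho \<longleftrightarrow> module.subspace sc V \<and>
     (\<forall>g\<in>carrier G. is_linear_on sc V (rho g)) \<and>
     (\<forall>v\<in>V. rho \<one>\<^bsub>G\<^esub> v = v) \<and>
     (\<forall>g\<in>carrier G. \<forall>h\<in>carrier G. \<forall>v\<in>V. rho (g \<otimes>\<^bsub>G\<^esub> h) v = rho g (rho h v))"

definition irreducible_rep :: "('k::field \<Rightarrow> 'v \<Rightarrow> 'v::ab_group_add) \<Rightarrow> ('g,'b) monoid_scheme \<Rightarrow> 'v set
                     \<Rightarrow> ('g \<Rightarrow> 'v \<Rightarrow> 'v) \<Rightarrow> bool" where
  "irreducible_rep sc G V rho \<longleftrightarrow> V \<noteq> {0} \<and>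
     (\<forall>U. module.subspace sc U \<and> U \<subseteq> V \<and> (\<forall>g\<in>carrier G. \<forall>u\<in>U. rho g u \<in> U)
          \<longrightarrow> U = {0} \<or> U = V)"

definition End_k :: "('k::field \<Rightarrow> 'v \<Rightarrow> 'v::ab_group_add) \<Rightarrow> 'v set \<Rightarrow> ('v \<Rightarrow> 'v) set" where
  "End_k sc V = {A. is_linear_on sc V A \<and> (\<forall>x. x \<notin> V \<longrightarrow> A x = 0)}"

definition restrict0 :: "'v set \<Rightarrow> ('v \<Rightarrow> 'v::zero) \<Rightarrow> ('v \<Rightarrow> 'v)" where
  "restrict0 V A = (\<lambda>x. if x \<in> V then A x else 0)"

definition escale :: "('k \<Rightarrow> 'v \<Rightarrow> 'v) \<Rightarrow> 'k \<Rightarrow> ('v \<Rightarrow> 'v) \<Rightarrow> ('v \<Rightarrow> 'v)" where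
  "escale sc c A = (\<lambda>x. sc c (A x))"

text \<open>A linear map A on V is semisimple (diagonalizable; k is algebraically closed)
  iff V is spanned by eigenvectors of A.\<close>
definition semisimple_on :: "('k::field \<Rightarrow> 'v \<Rightarrow> 'v::ab_group_add) \<Rightarrow> 'v set \<Rightarrow> ('v \<Rightarrow> 'v) \<Rightarrow> bool" where
  "semisimple_on sc V A \<longleftrightarrow>
     V \<subseteq> module.span sc {v \<in> V. v \<noteq> 0 \<and> (\<exists>e. A v = sc e v)}"

definition End_spanned_by_semisimple ::
  "('k::field \<Rightarrow> 'v \<Rightarrow> 'v::ab_group_add) \<Rightarrow> ('g,'b) monoid_scheme \<Rightarrow> 'v set \<Rightarrow> ('g \<Rightarrow> 'v \<Rightarrow> 'v) \<Rightarrow> bool" where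
  "End_spanned_by_semisimple sc G V rho \<longleftrightarrow>
     End_k sc V \<subseteq> module.span (escale sc)
        {restrict0 V (rho g) | g. g \<in> carrier G \<and> semisimple_on sc V (rho g)}"

definition H1_vanishes :: "('g,'b) monoid_scheme \<Rightarrow> 'm::ab_group_add set \<Rightarrow> ('g \<Rightarrow> 'm \<Rightarrow> 'm) \<Rightarrow> bool" where
  "H1_vanishes G M act \<longleftrightarrow>
     (\<forall>f. (\<forall>g\<in>carrier G. f g \<in> M) \<and>
          (\<forall>g\<in>carrier G. \<forall>h\<in>carrier G. f (g \<otimes>\<^bsub>G\<^esub> h) = f g + act g (f h))
       \<longrightarrow> (\<exists>m\<in>M. \<forall>g\<in>carrier G. f g = act g m - m))"

definition H1_trivial_vanishes :: "('g,'b) monoid_scheme \<Rightarrow> 'k::field itself \<Rightarrow> bool" where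
  "H1_trivial_vanishes G (_::'k itself) \<longleftrightarrow> H1_vanishes G (UNIV :: 'k set) (\<lambda>g x. x)"

text \<open>H^1(G, V \<otimes> V^*), using V \<otimes> V^* = End_k(V) with action A \<mapsto> rho(g) A rho(g)^{-1}.\<close>
definition H1_adjoint_vanishes ::
  "('k::field \<Rightarrow> 'v \<Rightarrow> 'v::ab_group_add) \<Rightarrow> ('g,'b) monoid_scheme \<Rightarrow> 'v set \<Rightarrow> ('g \<Rightarrow> 'v \<Rightarrow> 'v) \<Rightarrow> bool" where
  "H1_adjoint_vanishes sc G V rho \<longleftrightarrow>
     H1_vanishes G (End_k sc V) (\<lambda>g A. restrict0 V (rho g \<circ> A \<circ> rho (inv\<^bsub>G\<^esub> g)))"

definition adequate ::
  "nat \<Rightarrow> ('k::field \<Rightarrow> 'v \<Rightarrow> 'v::ab_group_add) \<Rightarrow> ('g,'b) monoid_scheme \<Rightarrow> 'v set \<Rightarrow> ('g \<Rightarrow> 'v \<Rightarrow> 'v) \<Rightarrow> bool" where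
  "adequate p sc G V rho \<longleftrightarrow>
     H1_trivial_vanishes G TYPE('k) \<and>
     \<not> p dvd vector_space.dim sc V \<and>
     H1_adjoint_vanishes sc G V rho \<and>
     End_spanned_by_semisimple sc G V rho"

end

theory Submission
  imports Defs "HOL-Algebra.Left_Coset"
begin

text \<open>
  Evaluating a function \<open>\<phi> \<in> V\<close> at the elements \<open>(1, t\<^sup>-\<^sup>1)\<close> identifies \<open>V\<close> with the space of
  functions on the set \<open>X\<close> of left cosets, with \<open>((f,s) v)(C) = \<chi>(f(C)) v(s\<^sup>-\<^sup>1 C)\<close>. So \<open>G\<close> acts by
  signed permutation matrices. Sign changes of single coordinates (available since \<open>2 \<noteq> 0\<close>) and
  transitivity of \<open>T\<close> on \<open>X\<close> give irreducibility.

  In matrix coordinates, the off-diagonal part of a cocycle with values in \<open>End(V)\<close> is a coboundary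
  because flipping the sign of coordinate \<open>C\<close> acts as \<open>-1\<close> on the \<open>(C,D)\<close> entry; the diagonal part
  is handled as in Shapiro's lemma, using that \<open>Hom(T\<^sub>1, k) = 0\<close> for a dihedral group when \<open>2 \<noteq> 0\<close>.

  If \<open>(f,s)\<close> acts semisimply, then its eigenvalues are roots of unity of order prime to \<open>p\<close>;
  as \<open>T\<close> acts faithfully on \<open>X\<close>, the order of \<open>s\<close> is prime to \<open>p\<close>, so \<open>s \<notin> t T\<^sub>1\<close>. Hence the matrix
  entry at position \<open>(t T\<^sub>1, T\<^sub>1)\<close> vanishes on the span of all semisimple elements.
\<close>

section \<open>Linear structure on functions and on operators\<close>

interpretation fs: vector_space "fscale :: 'k::field \<Rightarrow> ('g \<Rightarrow> 'k) \<Rightarrow> 'g \<Rightarrow> 'k"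
  by unfold_locales (auto simp: fscale_def algebra_simps)

text \<open>Spans inside \<open>End_k\<close> are taken with respect to \<open>escale\<close>, so
  the type of all operators has to carry a module structure.\<close>

lemma module_escale:
  assumes "Modules.module sc"
  shows "Modules.module (escale sc)"
proof -
  interpret Modules.module sc by fact
  show ?thesis
    by unfold_locales (auto simp: escale_def scale_right_distrib scale_left_distrib)
qed

interpretation es: Modules.module "escale (fscale :: 'k::field \<Rightarrow> ('g \<Rightarrow> 'k) \<Rightarrow> 'g \<Rightarrow> 'k)"
  by (rule module_escale) (rule fs.module_axioms)

lemma is_linear_on_comp:
  "\<lbrakk>is_linear_on sc V A; is_linear_on sc V B\<rbrakk> \<Longrightarrow> is_linear_on sc V (A \<circ> B)"
  by (simp add: is_linear_on_def)

lemma sum_fun_apply: "(\<Sum>i\<in>I. f i) x = (\<Sum>i\<in>I. f i x)"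
  by (induction I rule: infinite_finite_induct) auto

section \<open>The wreath product\<close>

text \<open>The setup for an arbitrary finite \<open>T\<close>; the characteristic, simplicity and
  the dihedral structure enter as hypotheses of individual lemmas.\<close>

locale wreath_sign = T: group T + L: group L
  for T :: "('a,'b) monoid_scheme" and L :: "('l,'c) monoid_scheme" +
  fixes T1 :: "'a set"
  assumes T1: "subgroup T1 T"
    and finite_T: "finite (carrier T)"
    and card_L: "card (carrier L) = 2"
begin

abbreviation G where "G \<equiv> wreath L T T1"
abbreviation X where "X \<equiv> lcosets_of T T1"

lemma coset_subset: "C \<in> X \<Longrightarrow> C \<subseteq> carrier T"
  using T.l_coset_subset_G[OF subgroup.subset[OF T1]] by (auto simp: lcosets_of_def)

lemma act_closed [simp]:
  assumes "s \<in> carrier T" "C \<in> X"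
  shows "s <#\<^bsub>T\<^esub> C \<in> X"
proof -
  obtain t where "t \<in> carrier T" "C = t <#\<^bsub>T\<^esub> T1"
    using assms(2) by (auto simp: lcosets_of_def)
  then show ?thesis
    using assms(1) subgroup.subset[OF T1] by (auto simp: lcosets_of_def T.lcos_m_assoc)
qed

lemma act_act [simp]:
  "\<lbrakk>s \<in> carrier T; t \<in> carrier T; C \<in> X\<rbrakk> \<Longrightarrow> s <#\<^bsub>T\<^esub> (t <#\<^bsub>T\<^esub> C) = (s \<otimes>\<^bsub>T\<^esub> t) <#\<^bsub>T\<^esub> C"
  by (simp add: T.lcos_m_assoc coset_subset)

lemma act_one [simp]: "C \<in> X \<Longrightarrow> \<one>\<^bsub>T\<^esub> <#\<^bsub>T\<^esub> C = C"
  by (simp add: T.lcos_mult_one coset_subset)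

lemma T1_in_X [simp]: "T1 \<in> X"
  using T.lcos_mult_one[OF subgroup.subset[OF T1]] T.one_closed
  by (force simp: lcosets_of_def)

lemma X_cases:
  assumes "C \<in> X"
  obtains t where "t \<in> carrier T" "C = t <#\<^bsub>T\<^esub> T1"
  using assms by (auto simp: lcosets_of_def)

lemma finite_X [simp]: "finite X"
proof -
  have "X = (\<lambda>t. t <#\<^bsub>T\<^esub> T1) ` carrier T"
    by (auto simp: lcosets_of_def)
  then show ?thesis by (simp add: finite_T)
qed

lemma act_eq_iff:
  assumes "s \<in> carrier T" "C \<in> X" "D \<in> X"
  shows "inv\<^bsub>T\<^esub> s <#\<^bsub>T\<^esub> C = D \<longleftrightarrow> C = s <#\<^bsub>T\<^esub> D"
  using assms by auto

lemma coset_eq_iff: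
  assumes "s \<in> carrier T" "t \<in> carrier T"
  shows "s <#\<^bsub>T\<^esub> T1 = t <#\<^bsub>T\<^esub> T1 \<longleftrightarrow> s \<in> t <#\<^bsub>T\<^esub> T1"
  using assms T.lcos_self[OF assms(1) T1] T.l_repr_independence[OF _ assms(2) T1] by metis

lemma act_T1: "t \<in> T1 \<Longrightarrow> t <#\<^bsub>T\<^esub> T1 = T1"
  using coset_eq_iff[of t "\<one>\<^bsub>T\<^esub>"] subgroup.mem_carrier[OF T1]
    T.lcos_mult_one[OF subgroup.subset[OF T1]] by auto

definition z where "z = (SOME l. l \<in> carrier L \<and> l \<noteq> \<one>\<^bsub>L\<^esub>)"

lemma z: "z \<in> carrier L" "z \<noteq> \<one>\<^bsub>L\<^esub>" "carrier L = {\<one>\<^bsub>L\<^esub>, z}"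
proof -
  obtain a b where ab: "carrier L = {a, b}" "a \<noteq> b"
    using card_L by (auto simp: card_2_iff)
  then have "\<exists>l. l \<in> carrier L \<and> l \<noteq> \<one>\<^bsub>L\<^esub>" by blast
  then have *: "z \<in> carrier L \<and> z \<noteq> \<one>\<^bsub>L\<^esub>" unfolding z_def by (rule someI_ex)
  then show "z \<in> carrier L" "z \<noteq> \<one>\<^bsub>L\<^esub>" by auto
  with ab L.one_closed show "carrier L = {\<one>\<^bsub>L\<^esub>, z}" by auto
qed

text \<open>The square is \<open>1\<close> or \<open>z\<close>, and \<open>z z = z\<close> would
  force \<open>z = 1\<close>.\<close>

lemma z_square: "z \<otimes>\<^bsub>L\<^esub> z = \<one>\<^bsub>L\<^esub>"
  using z L.m_closed[OF z(1) z(1)] L.l_cancel_one[OF z(1) z(1)] by auto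

lemma L_cases:
  assumes "l \<in> carrier L" obtains "l = \<one>\<^bsub>L\<^esub>" | "l = z"
  using assms z(3) by auto

lemma L_square: "l \<in> carrier L \<Longrightarrow> l \<otimes>\<^bsub>L\<^esub> l = \<one>\<^bsub>L\<^esub>"
  by (erule L_cases) (auto simp: z_square)

lemma L_comm: "\<lbrakk>l \<in> carrier L; l' \<in> carrier L\<rbrakk> \<Longrightarrow> l \<otimes>\<^bsub>L\<^esub> l' = l' \<otimes>\<^bsub>L\<^esub> l"
  by (elim L_cases) (auto simp: z)

text \<open>The sign character of \<open>L\<close>; \<open>W_char\<close> is its pullback along
  evaluation at the coset \<open>T1\<close>.\<close>

definition chi :: "'l \<Rightarrow> 'k::field" where
  "chi l = (if l = \<one>\<^bsub>L\<^esub> then 1 else -1)"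

lemma chi_one [simp]: "chi \<one>\<^bsub>L\<^esub> = 1" and chi_z [simp]: "chi z = -1"
  by (auto simp: chi_def z)

lemma chi_mult [simp]:
  "\<lbrakk>l \<in> carrier L; l' \<in> carrier L\<rbrakk> \<Longrightarrow> chi (l \<otimes>\<^bsub>L\<^esub> l') = chi l * chi l'"
  by (elim L_cases) (auto simp: z z_square)

lemma chi_square [simp]: "chi l * chi l = 1"
  by (auto simp: chi_def)

lemma chi_nonzero [simp]: "chi l \<noteq> 0"
  by (auto simp: chi_def)

lemma W_char_eq: "W_char L T1 x = chi (fst x T1)"
  by (simp add: W_char_def chi_def)

lemma G_carrier: "(f,t) \<in> carrier G \<longleftrightarrow> f \<in> X \<rightarrow>\<^sub>E carrier L \<and> t \<in> carrier T"
  by (simp add: wreath_def)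

lemma G_mult:
  "(f,t) \<otimes>\<^bsub>G\<^esub> (f',t') = (\<lambda>C\<in>X. f C \<otimes>\<^bsub>L\<^esub> f' (inv\<^bsub>T\<^esub> t <#\<^bsub>T\<^esub> C), t \<otimes>\<^bsub>T\<^esub> t')"
  by (simp add: wreath_def)

lemma G_one: "\<one>\<^bsub>G\<^esub> = (\<lambda>C\<in>X. \<one>\<^bsub>L\<^esub>, \<one>\<^bsub>T\<^esub>)"
  by (simp add: wreath_def)

lemma value_closed [simp]: "\<lbrakk>f \<in> X \<rightarrow>\<^sub>E carrier L; C \<in> X\<rbrakk> \<Longrightarrow> f C \<in> carrier L"
  by (rule PiE_mem)

lemma group_G: "group G"
proof (rule groupI)
  fix x y assume "x \<in> carrier G" "y \<in> carrier G"
  then show "x \<otimes>\<^bsub>G\<^esub> y \<in> carrier G"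
    by (cases x; cases y) (auto simp: G_carrier G_mult)
next
  show "\<one>\<^bsub>G\<^esub> \<in> carrier G"
    by (auto simp: G_carrier G_one)
next
  fix x y w assume "x \<in> carrier G" "y \<in> carrier G" "w \<in> carrier G"
  moreover obtain f s g t h u where "x = (f,s)" "y = (g,t)" "w = (h,u)"
    by (metis surj_pair)
  ultimately show "x \<otimes>\<^bsub>G\<^esub> y \<otimes>\<^bsub>G\<^esub> w = x \<otimes>\<^bsub>G\<^esub> (y \<otimes>\<^bsub>G\<^esub> w)"
    by (simp add: G_carrier G_mult T.m_assoc L.m_assoc T.inv_mult_group cong: restrict_cong)
next
  fix x assume "x \<in> carrier G"
  moreover obtain f s where x: "x = (f,s)"
    by (metis surj_pair)
  ultimately have fs: "f \<in> X \<rightarrow>\<^sub>E carrier L" "s \<in> carrier T"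
    by (auto simp: G_carrier)
  then have "(\<lambda>C\<in>X. f C) = f"
    by (rule_tac PiE_restrict)
  with fs show "\<one>\<^bsub>G\<^esub> \<otimes>\<^bsub>G\<^esub> x = x"
    by (simp add: x G_mult G_one cong: restrict_cong)
next
  fix x assume x: "x \<in> carrier G"
  obtain f t where [simp]: "x = (f,t)" by (cases x)
  from x have ft: "f \<in> X \<rightarrow>\<^sub>E carrier L" "t \<in> carrier T" by (auto simp: G_carrier)
  show "\<exists>y\<in>carrier G. y \<otimes>\<^bsub>G\<^esub> x = \<one>\<^bsub>G\<^esub>"
  proof
    \<comment> \<open>The product \<open>?y x\<close> has first component
      \<open>C \<mapsto> y C * f (t C)\<close>, where \<open>y\<close> is the first component of
      \<open>?y\<close>; this dictates the translate by \<open>t\<close>.\<close>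
    let ?y = "(\<lambda>C\<in>X. inv\<^bsub>L\<^esub> (f (t <#\<^bsub>T\<^esub> C)), inv\<^bsub>T\<^esub> t)"
    show "?y \<in> carrier G"
      using ft by (auto simp: G_carrier)
    show "?y \<otimes>\<^bsub>G\<^esub> x = \<one>\<^bsub>G\<^esub>"
      using ft by (auto simp: G_mult G_one intro!: restrict_ext)
  qed
qed

sublocale G: group G by (rule group_G)

section \<open>The induced module in coordinates\<close>

abbreviation V :: "(('a set \<Rightarrow> 'l) \<times> 'a \<Rightarrow> 'k::field) set" where
  "V \<equiv> induced_space G (wreath_K L T T1) (W_char L T1)"

abbreviation rho :: "('a set \<Rightarrow> 'l) \<times> 'a \<Rightarrow> (('a set \<Rightarrow> 'l) \<times> 'a \<Rightarrow> 'k::field) \<Rightarrow> ('a set \<Rightarrow> 'l) \<times> 'a \<Rightarrow> 'k" where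
  "rho \<equiv> induced_action G"

definition one_N where "one_N = (\<lambda>C\<in>X. \<one>\<^bsub>L\<^esub>)"

text \<open>Functions in \<open>V\<close> are invariant under \<open>T1\<close> on the left, so the
  value at \<open>inv t\<close> depends only on the left coset of \<open>t\<close>. The arbitrary
  representative is justified in \<open>coord_coset\<close>.\<close>

definition coord :: "(('a set \<Rightarrow> 'l) \<times> 'a \<Rightarrow> 'k::field) \<Rightarrow> 'a set \<Rightarrow> 'k" where
  "coord \<phi> C = \<phi> (one_N, inv\<^bsub>T\<^esub> (SOME t. t \<in> carrier T \<and> C = t <#\<^bsub>T\<^esub> T1))"

text \<open>Inverse of \<open>coord\<close>: the only element of \<open>V\<close> with coordinates
  \<open>v\<close>, forced by \<open>V_value\<close>.\<close>

definition of_coord :: "('a set \<Rightarrow> 'k::field) \<Rightarrow> ('a set \<Rightarrow> 'l) \<times> 'a \<Rightarrow> 'k" where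
  "of_coord v x = (if x \<in> carrier G then chi (fst x T1) * v (inv\<^bsub>T\<^esub> (snd x) <#\<^bsub>T\<^esub> T1) else 0)"

lemma one_N_closed [simp]: "one_N \<in> X \<rightarrow>\<^sub>E carrier L"
  by (auto simp: one_N_def)

lemma one_N_apply [simp]: "C \<in> X \<Longrightarrow> one_N C = \<one>\<^bsub>L\<^esub>"
  by (simp add: one_N_def)

lemma one_G: "\<one>\<^bsub>G\<^esub> = (one_N, \<one>\<^bsub>T\<^esub>)"
  by (simp add: G_one one_N_def)

lemma K_iff: "(f,t) \<in> wreath_K L T T1 \<longleftrightarrow> f \<in> X \<rightarrow>\<^sub>E carrier L \<and> t \<in> T1"
  using subgroup.mem_carrier[OF T1] by (auto simp: wreath_K_def G_carrier)

lemma subspace_V [simp]: "fs.subspace V"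
  by (rule fs.subspaceI) (auto simp: induced_space_def fscale_def algebra_simps)

lemma V_outside: "\<phi> \<in> V \<Longrightarrow> x \<notin> carrier G \<Longrightarrow> \<phi> x = 0"
  unfolding induced_space_def by blast

lemma V_mult:
  "\<lbrakk>\<phi> \<in> V; h \<in> wreath_K L T T1; x \<in> carrier G\<rbrakk> \<Longrightarrow> \<phi> (h \<otimes>\<^bsub>G\<^esub> x) = chi (fst h T1) * \<phi> x"
  by (auto simp: induced_space_def W_char_eq)

text \<open>Factor \<open>(f,t)\<close> as \<open>(f,1) (1,t)\<close>; the left factor lies in
  \<open>K\<close> and acts by its character.\<close>

lemma V_value:
  assumes "\<phi> \<in> V" "f \<in> X \<rightarrow>\<^sub>E carrier L" "t \<in> carrier T"
  shows "\<phi> (f,t) = chi (f T1) * \<phi> (one_N, t)"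
proof -
  have "(\<lambda>C\<in>X. f C) = f"
    using assms(2) by (rule PiE_restrict)
  then have "(f, \<one>\<^bsub>T\<^esub>) \<otimes>\<^bsub>G\<^esub> (one_N, t) = (f, t)"
    using assms by (simp add: G_mult cong: restrict_cong)
  moreover have "(f, \<one>\<^bsub>T\<^esub>) \<in> wreath_K L T T1"
    using assms subgroup.one_closed[OF T1] by (simp add: K_iff)
  ultimately show ?thesis
    using V_mult[OF assms(1), of "(f, \<one>\<^bsub>T\<^esub>)" "(one_N, t)"] assms by (simp add: G_carrier)
qed

lemma V_T1_invariant:
  assumes "\<phi> \<in> V" "t1 \<in> T1" "t \<in> carrier T"
  shows "\<phi> (one_N, t1 \<otimes>\<^bsub>T\<^esub> t) = \<phi> (one_N, t)"
proof -
  have t1: "t1 \<in> carrier T" using assms(2) subgroup.mem_carrier[OF T1] by blast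
  have "(one_N, t1) \<otimes>\<^bsub>G\<^esub> (one_N, t) = (one_N, t1 \<otimes>\<^bsub>T\<^esub> t)"
    using assms t1 by (simp add: G_mult one_N_def cong: restrict_cong)
  then show ?thesis
    using V_mult[OF assms(1), of "(one_N, t1)" "(one_N, t)"] assms by (simp add: G_carrier K_iff)
qed

text \<open>Two representatives of a coset differ by some \<open>h\<close> in \<open>T1\<close> on
  the right; inversion moves \<open>h\<close> to the left, where it is absorbed by
  invariance.\<close>

lemma coord_coset:
  assumes "\<phi> \<in> V" "t \<in> carrier T"
  shows "coord \<phi> (t <#\<^bsub>T\<^esub> T1) = \<phi> (one_N, inv\<^bsub>T\<^esub> t)"
proof -
  define s where "s = (SOME s. s \<in> carrier T \<and> t <#\<^bsub>T\<^esub> T1 = s <#\<^bsub>T\<^esub> T1)"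
  have "s \<in> carrier T \<and> t <#\<^bsub>T\<^esub> T1 = s <#\<^bsub>T\<^esub> T1"
    unfolding s_def by (rule someI[of _ t]) (use assms in auto)
  then have s: "s \<in> carrier T" "s \<in> t <#\<^bsub>T\<^esub> T1"
    using coset_eq_iff[of s t] assms by auto
  then obtain h where h: "h \<in> T1" "s = t \<otimes>\<^bsub>T\<^esub> h"
    by (auto simp: l_coset_def)
  moreover have "h \<in> carrier T" "inv\<^bsub>T\<^esub> h \<in> T1"
    using h T1 by (auto simp: subgroup.mem_carrier subgroup.m_inv_closed)
  ultimately have "inv\<^bsub>T\<^esub> s = inv\<^bsub>T\<^esub> h \<otimes>\<^bsub>T\<^esub> inv\<^bsub>T\<^esub> t" "inv\<^bsub>T\<^esub> h \<in> T1"
    using assms by (auto simp: T.inv_mult_group)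
  then show ?thesis
    using V_T1_invariant[OF assms(1), of "inv\<^bsub>T\<^esub> h" "inv\<^bsub>T\<^esub> t"] assms
    by (simp add: coord_def flip: s_def)
qed

lemma coord_inject:
  assumes "\<phi> \<in> V" "\<psi> \<in> V" "\<And>C. C \<in> X \<Longrightarrow> coord \<phi> C = coord \<psi> C"
  shows "\<phi> = \<psi>"
proof
  fix x :: "('a set \<Rightarrow> 'l) \<times> 'a"
  obtain f t where x: "x = (f,t)" by (cases x)
  show "\<phi> x = \<psi> x"
  proof (cases "x \<in> carrier G")
    case True
    then have ft: "f \<in> X \<rightarrow>\<^sub>E carrier L" "t \<in> carrier T" by (auto simp: x G_carrier)
    have "inv\<^bsub>T\<^esub> t <#\<^bsub>T\<^esub> T1 \<in> X" using ft by simp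
    from assms(3)[OF this] have "\<phi> (one_N, t) = \<psi> (one_N, t)"
      using coord_coset[OF assms(1), of "inv\<^bsub>T\<^esub> t"] coord_coset[OF assms(2), of "inv\<^bsub>T\<^esub> t"] ft by simp
    then show ?thesis
      using V_value[OF assms(1) ft] V_value[OF assms(2) ft] x by simp
  next
    case False
    then show ?thesis using assms V_outside by metis
  qed
qed

text \<open>The \<open>T\<close>-component \<open>s\<close> of an element of \<open>K\<close> lies
  in \<open>T1\<close> and fixes the coset \<open>T1\<close>. Hence left multiplication by
  \<open>(f,s)\<close> leaves both the sign of \<open>g\<close> and the coordinate of
  \<open>v\<close> in place and contributes only \<open>chi (f T1)\<close>.\<close>

lemma of_coord_in_V [simp]: "of_coord v \<in> V"
proof -
  have "of_coord v ((f,s) \<otimes>\<^bsub>G\<^esub> (g,t)) = chi (f T1) * of_coord v (g,t)"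
    if "(f,s) \<in> wreath_K L T T1" "(g,t) \<in> carrier G" for f s g t
  proof -
    have fs: "f \<in> X \<rightarrow>\<^sub>E carrier L" "s \<in> T1" "s \<in> carrier T" "inv\<^bsub>T\<^esub> s <#\<^bsub>T\<^esub> T1 = T1"
      using that subgroup.mem_carrier[OF T1] subgroup.m_inv_closed[OF T1] act_T1 by (auto simp: K_iff)
    have gt: "g \<in> X \<rightarrow>\<^sub>E carrier L" "t \<in> carrier T"
      using that by (auto simp: G_carrier)
    have "(f,s) \<otimes>\<^bsub>G\<^esub> (g,t) \<in> carrier G"
      using fs gt by (auto simp: G_carrier intro: G.m_closed)
    moreover have "inv\<^bsub>T\<^esub> (s \<otimes>\<^bsub>T\<^esub> t) <#\<^bsub>T\<^esub> T1 = inv\<^bsub>T\<^esub> t <#\<^bsub>T\<^esub> (inv\<^bsub>T\<^esub> s <#\<^bsub>T\<^esub> T1)"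
      using fs(3) gt by (simp add: T.inv_mult_group)
    ultimately show ?thesis
      using fs gt that(2) by (simp add: of_coord_def G_mult)
  qed
  then have "of_coord v (h \<otimes>\<^bsub>G\<^esub> x) = chi (fst h T1) * of_coord v x"
    if "h \<in> wreath_K L T T1" "x \<in> carrier G" for h x
    using that by (cases h; cases x) simp
  moreover have "of_coord v x = 0" if "x \<notin> carrier G" for x
    using that by (simp add: of_coord_def)
  ultimately show ?thesis
    unfolding induced_space_def W_char_eq by blast
qed

lemma coord_of_coord [simp]:
  assumes "C \<in> X" shows "coord (of_coord v) C = v C"
  using assms
proof (rule X_cases)
  fix t assume "t \<in> carrier T" "C = t <#\<^bsub>T\<^esub> T1"
  then show ?thesis
    by (simp add: coord_coset of_coord_def G_carrier)
qed

lemma coord_zero [simp]: "coord 0 C = 0"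
  and coord_add [simp]: "coord (\<phi> + \<psi>) C = coord \<phi> C + coord \<psi> C"
  and coord_diff [simp]: "coord (\<phi> - \<psi>) C = coord \<phi> C - coord \<psi> C"
  and coord_scale [simp]: "coord (fscale c \<phi>) C = c * coord \<phi> C"
  and coord_sum: "coord (\<Sum>i\<in>I. F i) C = (\<Sum>i\<in>I. coord (F i) C)"
  by (simp_all add: coord_def fscale_def sum_fun_apply)

lemma rho_closed:
  assumes "g \<in> carrier G" "\<phi> \<in> V"
  shows "rho g \<phi> \<in> V"
proof -
  have "h \<in> carrier G" if "h \<in> wreath_K L T T1" for h
    using that by (auto simp: wreath_K_def)
  then show ?thesis
    using assms by (auto simp: induced_space_def induced_action_def G.m_assoc)
qed

text \<open>The action is by signed permutations: \<open>(1, inv t) (f,s)\<close> has first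
  component \<open>D \<mapsto> f (t D)\<close>, whose value at \<open>T1\<close> is
  \<open>f C\<close>, and second component \<open>inv t s\<close>.\<close>

lemma coord_rho [simp]:
  assumes "f \<in> X \<rightarrow>\<^sub>E carrier L" "s \<in> carrier T" "\<phi> \<in> V" "C \<in> X"
  shows "coord (rho (f,s) \<phi>) C = chi (f C) * coord \<phi> (inv\<^bsub>T\<^esub> s <#\<^bsub>T\<^esub> C)"
  using assms(4)
proof (rule X_cases)
  fix t assume t: "t \<in> carrier T" "C = t <#\<^bsub>T\<^esub> T1"
  let ?f = "\<lambda>D\<in>X. f (t <#\<^bsub>T\<^esub> D)"
  have f: "?f \<in> X \<rightarrow>\<^sub>E carrier L" using assms t by auto
  have "(one_N, inv\<^bsub>T\<^esub> t) \<otimes>\<^bsub>G\<^esub> (f, s) = (?f, inv\<^bsub>T\<^esub> t \<otimes>\<^bsub>T\<^esub> s)"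
    using assms t by (simp add: G_mult cong: restrict_cong)
  moreover have "coord (rho (f,s) \<phi>) C = rho (f,s) \<phi> (one_N, inv\<^bsub>T\<^esub> t)"
    using assms t by (simp add: coord_coset rho_closed G_carrier)
  ultimately have "coord (rho (f,s) \<phi>) C = chi (f C) * \<phi> (one_N, inv\<^bsub>T\<^esub> t \<otimes>\<^bsub>T\<^esub> s)"
    using assms t V_value[OF assms(3) f, of "inv\<^bsub>T\<^esub> t \<otimes>\<^bsub>T\<^esub> s"]
    by (simp add: induced_action_def G_carrier)
  \<comment> \<open>Writing the second component as an inverse exhibits the value as the coordinate
    at \<open>inv s t T1\<close>, which is \<open>inv s C\<close>.\<close>
  moreover have "inv\<^bsub>T\<^esub> (inv\<^bsub>T\<^esub> s \<otimes>\<^bsub>T\<^esub> t) = inv\<^bsub>T\<^esub> t \<otimes>\<^bsub>T\<^esub> s"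
    using assms t by (simp add: T.inv_mult_group)
  ultimately show ?thesis
    using coord_coset[OF assms(3), of "inv\<^bsub>T\<^esub> s \<otimes>\<^bsub>T\<^esub> t"] assms t by simp
qed

lemma rho_linear: "g \<in> carrier G \<Longrightarrow> is_linear_on fscale V (rho g)"
  using rho_closed[of g] by (auto simp: is_linear_on_def induced_action_def fscale_def)

lemma rho_one: "\<phi> \<in> V \<Longrightarrow> rho \<one>\<^bsub>G\<^esub> \<phi> = \<phi>"
  by (auto simp: induced_action_def V_outside)

lemma rho_mult: "\<lbrakk>g \<in> carrier G; h \<in> carrier G\<rbrakk> \<Longrightarrow> rho (g \<otimes>\<^bsub>G\<^esub> h) \<phi> = rho g (rho h \<phi>)"
  by (auto simp: induced_action_def G.m_assoc)

lemma is_rep_V: "is_rep fscale G V rho"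
  by (simp add: is_rep_def rho_linear rho_one rho_mult)

section \<open>Standard basis and dimension\<close>

definition e where "e D = of_coord (\<lambda>C. if C = D then 1 else 0)"

lemma e_in_V [simp]: "e D \<in> V"
  by (simp add: e_def)

lemma coord_e [simp]: "C \<in> X \<Longrightarrow> coord (e D) C = (if C = D then 1 else 0)"
  by (simp add: e_def)

lemma e_expand: 
  assumes "\<phi> \<in> V"
  shows "\<phi> = (\<Sum>D\<in>X. fscale (coord \<phi> D) (e D))"
proof (rule coord_inject[OF assms])
  show "(\<Sum>D\<in>X. fscale (coord \<phi> D) (e D)) \<in> V"
    by (intro fs.subspace_sum fs.subspace_scale) auto
  fix C assume "C \<in> X"
  then show "coord \<phi> C = coord (\<Sum>D\<in>X. fscale (coord \<phi> D) (e D)) C"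
    by (simp add: coord_sum if_distrib cong: if_cong)
qed

text \<open>The reduction to basis vectors behind the spanning set of \<open>dim_V\<close>,
  irreducibility, and equality of endomorphisms.\<close>

lemma V_subset:
  fixes U :: "(('a set \<Rightarrow> 'l) \<times> 'a \<Rightarrow> 'k::field) set"
  assumes "fs.subspace U" "\<And>D. D \<in> X \<Longrightarrow> e D \<in> U"
  shows "V \<subseteq> U"
proof
  fix \<phi> :: "_ \<Rightarrow> 'k" assume "\<phi> \<in> V"
  show "\<phi> \<in> U"
    by (subst e_expand[OF \<open>\<phi> \<in> V\<close>]) (intro fs.subspace_sum fs.subspace_scale assms)
qed

lemma inj_e: "inj_on (e :: _ \<Rightarrow> _ \<Rightarrow> 'k::field) X"
proof (rule inj_onI)
  fix C D assume "C \<in> X" "D \<in> X" "e C = (e D :: _ \<Rightarrow> 'k)"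
  then have "coord (e C :: _ \<Rightarrow> 'k) C = coord (e D) C" by simp
  with \<open>C \<in> X\<close> show "C = D" by (simp split: if_splits)
qed

lemma dim_V: "fs.dim (V :: (_ \<Rightarrow> 'k::field) set) = card X"
proof (rule fs.dim_unique)
  let ?B = "(e :: _ \<Rightarrow> _ \<Rightarrow> 'k) ` X"
  show "?B \<subseteq> V" by auto
  show "V \<subseteq> fs.span ?B"
    by (rule V_subset) (auto intro: fs.span_base)
  show "fs.independent ?B"
  proof
    assume "fs.dependent ?B"
    then obtain u D where u: "D \<in> X" "u (e D) \<noteq> 0" "(\<Sum>v\<in>?B. fscale (u v) v) = 0"
      by (auto simp: fs.dependent_finite)
    \<comment> \<open>Coordinate \<open>D\<close> of the linear relation isolates the coefficient of
      \<open>e D\<close>.\<close>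
    have "0 = coord (\<Sum>v\<in>?B. fscale (u v) v) D"
      using u(3) by simp
    also have "\<dots> = u (e D)"
      using u(1) by (simp add: sum.reindex[OF inj_e] coord_sum if_distrib cong: if_cong)
    finally show False using u(2) by simp
  qed
  show "card ?B = card X" by (simp add: card_image inj_e)
qed

section \<open>Sign changes of single coordinates and irreducibility\<close>

definition flip where "flip C = (\<lambda>D\<in>X. if D = C then z else \<one>\<^bsub>L\<^esub>)"

lemma flip_closed [simp]: "flip C \<in> X \<rightarrow>\<^sub>E carrier L"
  by (auto simp: flip_def z)

lemma flip_apply [simp]: "D \<in> X \<Longrightarrow> flip C D = (if D = C then z else \<one>\<^bsub>L\<^esub>)"
  by (simp add: flip_def)

lemma rho_e:
  assumes "f \<in> X \<rightarrow>\<^sub>E carrier L" "s \<in> carrier T" "D \<in> X"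
  shows "rho (f,s) (e D) = fscale (chi (f (s <#\<^bsub>T\<^esub> D))) (e (s <#\<^bsub>T\<^esub> D))"
proof (rule coord_inject)
  show "rho (f,s) (e D) \<in> V" using assms by (simp add: rho_closed G_carrier)
  show "fscale (chi (f (s <#\<^bsub>T\<^esub> D))) (e (s <#\<^bsub>T\<^esub> D)) \<in> V" by (simp add: fs.subspace_scale)
  fix C assume "C \<in> X"
  then show "coord (rho (f,s) (e D)) C = coord (fscale (chi (f (s <#\<^bsub>T\<^esub> D))) (e (s <#\<^bsub>T\<^esub> D))) C"
    using assms act_eq_iff by auto
qed

text \<open>A nonzero invariant subspace contains some basis vector by a sign change, and then all
  of them by transitivity.\<close>

lemma irreducible_V:
  assumes "(2::'k::field) \<noteq> 0"
  shows "irreducible_rep fscale G (V :: (_ \<Rightarrow> 'k) set) rho"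
proof -
  have "U = V" if U: "fs.subspace U" "U \<subseteq> V" "\<forall>g\<in>carrier G. \<forall>u\<in>U. rho g u \<in> U" and "U \<noteq> {0}"
    for U :: "(_ \<Rightarrow> 'k) set"
  proof -
    obtain u where u: "u \<in> U" "u \<noteq> 0"
      using \<open>U \<noteq> {0}\<close> fs.subspace_0[OF U(1)] by auto
    then obtain C where C: "C \<in> X" "coord u C \<noteq> 0"
      using coord_inject[of u 0] U(2) fs.subspace_0[OF subspace_V] by auto
    define a where "a = 2 * coord u C"
    have a: "a \<noteq> 0" using assms C by (simp add: a_def)
    \<comment> \<open>The sign change at \<open>C\<close> cancels every other coordinate and doubles
      this one; the factor \<open>2\<close> is invertible by assumption.\<close>
    have "u - rho (flip C, \<one>\<^bsub>T\<^esub>) u = fscale a (e C)"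
    proof (rule coord_inject)
      show "u - rho (flip C, \<one>\<^bsub>T\<^esub>) u \<in> V"
        using u U(2) by (intro fs.subspace_diff rho_closed) (auto simp: G_carrier)
      show "fscale a (e C) \<in> V"
        by (simp add: fs.subspace_scale)
      show "coord (u - rho (flip C, \<one>\<^bsub>T\<^esub>) u) D = coord (fscale a (e C)) D" if "D \<in> X" for D
        using that C u U(2) by (cases "D = C") (simp_all add: a_def subset_iff)
    qed
    moreover have "u - rho (flip C, \<one>\<^bsub>T\<^esub>) u \<in> U"
      using u U by (intro fs.subspace_diff) (auto simp: G_carrier)
    ultimately have "fscale a (e C) \<in> U" by simp
    then have "fscale (inverse a) (fscale a (e C)) \<in> U"
      by (rule fs.subspace_scale[OF U(1)])
    then have eC: "e C \<in> U"
      using a by simp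
    have "e D \<in> U" if "D \<in> X" for D
    proof -
      obtain c where c: "c \<in> carrier T" "C = c <#\<^bsub>T\<^esub> T1"
        by (rule X_cases[OF C(1)])
      obtain d where d: "d \<in> carrier T" "D = d <#\<^bsub>T\<^esub> T1"
        by (rule X_cases[OF \<open>D \<in> X\<close>])
      note cd = c d
      \<comment> \<open>The element \<open>d (inv c)\<close> of \<open>T\<close> carries
        \<open>C = c T1\<close> to \<open>D = d T1\<close>.\<close>
      have "rho (one_N, d \<otimes>\<^bsub>T\<^esub> inv\<^bsub>T\<^esub> c) (e C) \<in> U"
        using eC U(3) cd by (auto simp: G_carrier)
      moreover have "(d \<otimes>\<^bsub>T\<^esub> inv\<^bsub>T\<^esub> c) <#\<^bsub>T\<^esub> C = D"
        using cd by (simp add: T.m_assoc)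
      ultimately show ?thesis
        using cd that C(1) by (simp add: rho_e)
    qed
    then have "V \<subseteq> U" by (rule V_subset[OF U(1)])
    then show ?thesis
      using U(2) by blast
  qed
  moreover have "(V :: (_ \<Rightarrow> 'k) set) \<noteq> {0}"
  proof
    assume "(V :: (_ \<Rightarrow> 'k) set) = {0}"
    then have "e T1 = (0 :: _ \<Rightarrow> 'k)" using e_in_V by blast
    then have "coord (e T1) T1 = (0::'k)" by simp
    then show False by simp
  qed
  ultimately show ?thesis
    by (auto simp: irreducible_rep_def)
qed

section \<open>Cohomology of the endomorphism ring\<close>

abbreviation E where "E \<equiv> End_k fscale V"

text \<open>Matrix entry in row \<open>C\<close> and column \<open>D\<close> with respect to the
  basis \<open>e\<close>.\<close>

definition entry where "entry A C D = coord (A (e D)) C"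

lemma E_D:
  assumes "A \<in> E"
  shows "\<phi> \<in> V \<Longrightarrow> A \<phi> \<in> V" "\<lbrakk>\<phi> \<in> V; \<psi> \<in> V\<rbrakk> \<Longrightarrow> A (\<phi> + \<psi>) = A \<phi> + A \<psi>"
    "\<phi> \<in> V \<Longrightarrow> A (fscale c \<phi>) = fscale c (A \<phi>)" "\<phi> \<notin> V \<Longrightarrow> A \<phi> = 0" "A 0 = 0"
proof -
  show *: "\<phi> \<in> V \<Longrightarrow> A \<phi> \<in> V" "\<lbrakk>\<phi> \<in> V; \<psi> \<in> V\<rbrakk> \<Longrightarrow> A (\<phi> + \<psi>) = A \<phi> + A \<psi>"
    "\<phi> \<in> V \<Longrightarrow> A (fscale c \<phi>) = fscale c (A \<phi>)" "\<phi> \<notin> V \<Longrightarrow> A \<phi> = 0" for \<phi> \<psi> c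
    using assms by (simp_all add: End_k_def is_linear_on_def)
  show "A 0 = 0"
    using *(3)[of 0 0] fs.subspace_0[OF subspace_V] by simp
qed

lemma subspace_E: "es.subspace E"
  by (rule es.subspaceI)
    (auto simp: End_k_def is_linear_on_def escale_def fs.scale_right_distrib fs.subspace_0
      fs.subspace_add fs.subspace_scale mult.commute)

lemma restrict0_in_E:
  assumes "is_linear_on fscale V A"
  shows "restrict0 V A \<in> E"
  using assms fs.subspace_add[OF subspace_V] fs.subspace_scale[OF subspace_V]
  by (auto simp: End_k_def restrict0_def is_linear_on_def)

text \<open>Elements of \<open>E\<close> are zero outside \<open>V\<close>, and on \<open>V\<close>
  they are determined by the basis vectors.\<close>

lemma E_inject:
  assumes "A \<in> E" "B \<in> E" "\<And>C D. C \<in> X \<Longrightarrow> D \<in> X \<Longrightarrow> entry A C D = entry B C D"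
  shows "A = B"
proof -
  have "V \<subseteq> {\<phi> \<in> V. A \<phi> = B \<phi>}"
  proof (rule V_subset)
    show "fs.subspace {\<phi> \<in> V. A \<phi> = B \<phi>}"
      by (rule fs.subspaceI)
        (auto simp: E_D[OF assms(1)] E_D[OF assms(2)] fs.subspace_0 fs.subspace_add fs.subspace_scale)
    fix D assume "D \<in> X"
    then show "e D \<in> {\<phi> \<in> V. A \<phi> = B \<phi>}"
      using assms(3) E_D(1)[OF assms(1)] E_D(1)[OF assms(2)]
      by (auto simp: entry_def intro: coord_inject)
  qed
  then show ?thesis
    using E_D(4)[OF assms(1)] E_D(4)[OF assms(2)] by fastforce
qed

text \<open>With \<open>E_inject\<close>, this identifies \<open>E\<close> with all matrices indexed
  by cosets; \<open>restrict0\<close> supplies the value zero outside \<open>V\<close> that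
  \<open>End_k\<close> demands.\<close>

lemma entry_surj:
  obtains A where "A \<in> E" "\<And>C D. C \<in> X \<Longrightarrow> D \<in> X \<Longrightarrow> entry A C D = a C D"
proof
  let ?A = "\<lambda>\<phi>. of_coord (\<lambda>C. \<Sum>D\<in>X. a C D * coord \<phi> D)"
  show "restrict0 V ?A \<in> E"
  proof (rule restrict0_in_E, unfold is_linear_on_def, safe)
    show "?A \<phi> \<in> V" for \<phi> by simp
    show "?A (\<phi> + \<psi>) = ?A \<phi> + ?A \<psi>" for \<phi> \<psi>
      by (rule coord_inject) (auto simp: fs.subspace_add sum.distrib distrib_left)
    show "?A (fscale c \<phi>) = fscale c (?A \<phi>)" for c \<phi>
      by (rule coord_inject) (auto simp: fs.subspace_scale sum_distrib_left mult.left_commute)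
  qed
  show "entry (restrict0 V ?A) C D = a C D" if "C \<in> X" "D \<in> X" for C D
    using that by (simp add: entry_def restrict0_def if_distrib cong: if_cong)
qed

lemma rho_scale: "rho g (fscale c \<phi>) = fscale c (rho g \<phi>)"
  by (auto simp: induced_action_def fscale_def)

text \<open>No formula for inverses in the wreath product is needed: \<open>rho (f,s)\<close> sends
  the right-hand side to \<open>e D\<close> because the two equal signs cancel, and then
  \<open>rho (inv g)\<close> undoes \<open>rho g\<close>.\<close>

lemma rho_inv_e:
  assumes "(f,s) \<in> carrier G" "D \<in> X"
  shows "rho (inv\<^bsub>G\<^esub> (f,s)) (e D) = fscale (chi (f D)) (e (inv\<^bsub>T\<^esub> s <#\<^bsub>T\<^esub> D))"
proof -
  have fs: "f \<in> X \<rightarrow>\<^sub>E carrier L" "s \<in> carrier T" using assms by (auto simp: G_carrier)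
  let ?e = "e (inv\<^bsub>T\<^esub> s <#\<^bsub>T\<^esub> D)"
  have "fscale (chi (f D)) ?e = rho (inv\<^bsub>G\<^esub> (f,s) \<otimes>\<^bsub>G\<^esub> (f,s)) (fscale (chi (f D)) ?e)"
    using assms(1) by (simp add: rho_one fs.subspace_scale del: fs.scale_scale)
  also have "\<dots> = rho (inv\<^bsub>G\<^esub> (f,s)) (rho (f,s) (fscale (chi (f D)) ?e))"
    using assms(1) by (intro rho_mult) auto
  also have "rho (f,s) (fscale (chi (f D)) ?e) = fscale (chi (f D)) (rho (f,s) ?e)"
    by (rule rho_scale)
  also have "\<dots> = e D"
    using fs assms by (simp add: rho_e)
  finally show ?thesis by (rule sym)
qed

text \<open>In matrix terms, \<open>T\<close> permutes positions and the base group acts on position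
  \<open>(C,D)\<close> by a product of two signs. On the diagonal the signs cancel, which is why the
  two kinds of entries are treated separately below.\<close>

lemma entry_conj:
  assumes "(f,s) \<in> carrier G" "A \<in> E" "C \<in> X" "D \<in> X"
  shows "entry (restrict0 V (rho (f,s) \<circ> A \<circ> rho (inv\<^bsub>G\<^esub> (f,s)))) C D =
    chi (f C) * chi (f D) * entry A (inv\<^bsub>T\<^esub> s <#\<^bsub>T\<^esub> C) (inv\<^bsub>T\<^esub> s <#\<^bsub>T\<^esub> D)"
proof -
  have fs: "f \<in> X \<rightarrow>\<^sub>E carrier L" "s \<in> carrier T" using assms by (auto simp: G_carrier)
  then show ?thesis
    using assms by (simp add: entry_def restrict0_def rho_inv_e E_D[OF assms(2)] fs.subspace_scale)
qed

lemma conj_in_E: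
  assumes "g \<in> carrier G" "A \<in> E"
  shows "restrict0 V (rho g \<circ> A \<circ> rho (inv\<^bsub>G\<^esub> g)) \<in> E"
  using assms(2) rho_linear[OF assms(1)] rho_linear[OF G.inv_closed[OF assms(1)]]
  by (intro restrict0_in_E is_linear_on_comp) (auto simp: End_k_def)

text \<open>\<open>hom0\<close> is the hypothesis \<open>Hom(T\<^sub>1, k) = 0\<close>, needed only for the diagonal entries.\<close>

lemma matrix_cocycle_trivial:
  fixes F :: "('a set \<Rightarrow> 'l) \<times> 'a \<Rightarrow> 'a set \<Rightarrow> 'a set \<Rightarrow> 'k::field"
  assumes two: "(2::'k) \<noteq> 0"
    and hom0: "\<And>h :: 'a \<Rightarrow> 'k. \<lbrakk>\<And>s t. \<lbrakk>s \<in> T1; t \<in> T1\<rbrakk> \<Longrightarrow> h (s \<otimes>\<^bsub>T\<^esub> t) = h s + h t\<rbrakk>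
      \<Longrightarrow> \<forall>t\<in>T1. h t = 0"
    and cocycle: "\<And>f s g t C D. \<lbrakk>(f,s) \<in> carrier G; (g,t) \<in> carrier G; C \<in> X; D \<in> X\<rbrakk> \<Longrightarrow>
      F ((f,s) \<otimes>\<^bsub>G\<^esub> (g,t)) C D =
        F (f,s) C D + chi (f C) * chi (f D) * F (g,t) (inv\<^bsub>T\<^esub> s <#\<^bsub>T\<^esub> C) (inv\<^bsub>T\<^esub> s <#\<^bsub>T\<^esub> D)"
  obtains a where "\<And>f s C D. \<lbrakk>(f,s) \<in> carrier G; C \<in> X; D \<in> X\<rbrakk> \<Longrightarrow>
    F (f,s) C D = chi (f C) * chi (f D) * a (inv\<^bsub>T\<^esub> s <#\<^bsub>T\<^esub> C) (inv\<^bsub>T\<^esub> s <#\<^bsub>T\<^esub> D) - a C D"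
proof -
  have off_diag: "F (f,s) C D = chi (f C) * chi (f D)
      * (- F (flip (inv\<^bsub>T\<^esub> s <#\<^bsub>T\<^esub> C), \<one>\<^bsub>T\<^esub>) (inv\<^bsub>T\<^esub> s <#\<^bsub>T\<^esub> C) (inv\<^bsub>T\<^esub> s <#\<^bsub>T\<^esub> D) / 2)
      - (- F (flip C, \<one>\<^bsub>T\<^esub>) C D / 2)"
    if "(f,s) \<in> carrier G" "C \<in> X" "D \<in> X" "C \<noteq> D" for f s C D
  proof -
    have fs: "f \<in> X \<rightarrow>\<^sub>E carrier L" "s \<in> carrier T" using that by (auto simp: G_carrier)
    let ?C = "inv\<^bsub>T\<^esub> s <#\<^bsub>T\<^esub> C" and ?D = "inv\<^bsub>T\<^esub> s <#\<^bsub>T\<^esub> D"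
    \<comment> \<open>the two ways of writing \<open>(flip C, 1) (f,s) = (f,s) (flip (s\<^sup>-\<^sup>1 C), 1)\<close> determine \<open>2 F (f,s) C D\<close>\<close>
    have "flip C B \<otimes>\<^bsub>L\<^esub> f B = f B \<otimes>\<^bsub>L\<^esub> flip ?C (inv\<^bsub>T\<^esub> s <#\<^bsub>T\<^esub> B)" if "B \<in> X" for B
      using act_eq_iff[of s B ?C] fs that \<open>C \<in> X\<close> L_comm[OF z(1), of "f C"]
      by (cases "B = C") simp_all
    then have "(flip C, \<one>\<^bsub>T\<^esub>) \<otimes>\<^bsub>G\<^esub> (f,s) = (f,s) \<otimes>\<^bsub>G\<^esub> (flip ?C, \<one>\<^bsub>T\<^esub>)"
      using fs by (simp add: G_mult cong: restrict_cong)
    \<comment> \<open>As \<open>C \<noteq> D\<close>, the element \<open>flip C\<close> has sign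
      \<open>-1\<close> at \<open>C\<close> and \<open>1\<close> at \<open>D\<close>, so it negates
      this entry.\<close>
    moreover have "F ((flip C, \<one>\<^bsub>T\<^esub>) \<otimes>\<^bsub>G\<^esub> (f,s)) C D = F (flip C, \<one>\<^bsub>T\<^esub>) C D - F (f,s) C D"
      using that fs by (subst cocycle) (auto simp: G_carrier)
    moreover have "F ((f,s) \<otimes>\<^bsub>G\<^esub> (flip ?C, \<one>\<^bsub>T\<^esub>)) C D =
        F (f,s) C D + chi (f C) * chi (f D) * F (flip ?C, \<one>\<^bsub>T\<^esub>) ?C ?D"
      using that fs by (subst cocycle) (auto simp: G_carrier)
    ultimately have "2 * F (f,s) C D =
        F (flip C, \<one>\<^bsub>T\<^esub>) C D - chi (f C) * chi (f D) * F (flip ?C, \<one>\<^bsub>T\<^esub>) ?C ?D"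
      by (simp add: algebra_simps)
    then show ?thesis
      using two by (simp add: field_simps)
  qed
  \<comment> \<open>The diagonal of the cocycle, restricted to \<open>T\<close>: a cocycle with
    values in the permutation module of functions on \<open>X\<close>.\<close>
  define d where "d s C = F (one_N, s) C C" for s C
  have d_mult: "d (s \<otimes>\<^bsub>T\<^esub> t) C = d s C + d t (inv\<^bsub>T\<^esub> s <#\<^bsub>T\<^esub> C)"
    if "s \<in> carrier T" "t \<in> carrier T" "C \<in> X" for s t C
  proof -
    have "(one_N, s) \<otimes>\<^bsub>G\<^esub> (one_N, t) = (one_N, s \<otimes>\<^bsub>T\<^esub> t)"
      using that by (simp add: G_mult one_N_def cong: restrict_cong)
    then show ?thesis
      using cocycle[of one_N s one_N t C C] that by (simp add: d_def G_carrier)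
  qed
  \<comment> \<open>The base group contributes nothing on the diagonal: it acts trivially there and
    its elements square to \<open>1\<close>, so \<open>2 F (f,1) C C = 0\<close>.\<close>
  have F_diag: "F (f,s) C C = d s C" if "(f,s) \<in> carrier G" "C \<in> X" for f s C
  proof -
    have fs: "f \<in> X \<rightarrow>\<^sub>E carrier L" "s \<in> carrier T" using that by (auto simp: G_carrier)
    have "(\<lambda>C\<in>X. f C) = f" using fs(1) by (rule PiE_restrict)
    then have 1: "(f,\<one>\<^bsub>T\<^esub>) \<otimes>\<^bsub>G\<^esub> (one_N, s) = (f,s)"
      using fs by (simp add: G_mult cong: restrict_cong)
    have "(f,\<one>\<^bsub>T\<^esub>) \<otimes>\<^bsub>G\<^esub> (f,\<one>\<^bsub>T\<^esub>) = (one_N,\<one>\<^bsub>T\<^esub>)"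
      using fs by (simp add: G_mult one_N_def L_square cong: restrict_cong)
    then have "2 * F (f,\<one>\<^bsub>T\<^esub>) C C = d \<one>\<^bsub>T\<^esub> C"
      using cocycle[of f "\<one>\<^bsub>T\<^esub>" f "\<one>\<^bsub>T\<^esub>" C C] fs that by (simp add: G_carrier d_def)
    moreover have "(2::'k) \<noteq> 1"
      by (metis add_cancel_right_right one_add_one zero_neq_one)
    then have "d \<one>\<^bsub>T\<^esub> C = 0"
      using d_mult[of "\<one>\<^bsub>T\<^esub>" "\<one>\<^bsub>T\<^esub>" C] that by simp
    ultimately have "F (f,\<one>\<^bsub>T\<^esub>) C C = 0" using two by simp
    then show ?thesis
      using 1 cocycle[of f "\<one>\<^bsub>T\<^esub>" one_N s C C] fs that by (simp add: G_carrier d_def)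
  qed
  \<comment> \<open>Since \<open>T1\<close> fixes its own coset, the cocycle at that coset restricts
    to a homomorphism from \<open>T1\<close> to the field.\<close>
  have d_T1: "d t T1 = 0" if "t \<in> T1" for t
  proof -
    have "\<forall>t\<in>T1. d t T1 = 0"
    proof (rule hom0)
      fix s t assume "s \<in> T1" "t \<in> T1"
      then show "d (s \<otimes>\<^bsub>T\<^esub> t) T1 = d s T1 + d t T1"
        using d_mult[of s t T1] subgroup.mem_carrier[OF T1] subgroup.m_inv_closed[OF T1] act_T1 by simp
    qed
    then show ?thesis using that by blast
  qed
  \<comment> \<open>independent of the chosen representative because \<open>d\<close> vanishes on the stabilizer of \<open>T1\<close>\<close>
  define b where "b C = - d (SOME s. s \<in> carrier T \<and> C = s <#\<^bsub>T\<^esub> T1) C" for C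
  have b: "b (t <#\<^bsub>T\<^esub> T1) = - d t (t <#\<^bsub>T\<^esub> T1)" if t: "t \<in> carrier T" for t
  proof -
    define s where "s = (SOME s. s \<in> carrier T \<and> t <#\<^bsub>T\<^esub> T1 = s <#\<^bsub>T\<^esub> T1)"
    have "s \<in> carrier T \<and> t <#\<^bsub>T\<^esub> T1 = s <#\<^bsub>T\<^esub> T1"
      unfolding s_def by (rule someI[of _ t]) (use t in auto)
    then have "s \<in> t <#\<^bsub>T\<^esub> T1"
      using coset_eq_iff[of s t] t by auto
    then obtain h where h: "h \<in> T1" "s = t \<otimes>\<^bsub>T\<^esub> h"
      by (auto simp: l_coset_def)
    then have "d s (t <#\<^bsub>T\<^esub> T1) = d t (t <#\<^bsub>T\<^esub> T1)"
      using d_mult[of t h "t <#\<^bsub>T\<^esub> T1"] t subgroup.mem_carrier[OF T1] d_T1 by simp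
    then show ?thesis
      by (simp add: b_def flip: s_def)
  qed
  have diag: "d s C = b (inv\<^bsub>T\<^esub> s <#\<^bsub>T\<^esub> C) - b C" if "s \<in> carrier T" "C \<in> X" for s C
    using that(2)
  proof (rule X_cases)
    fix t assume t: "t \<in> carrier T" "C = t <#\<^bsub>T\<^esub> T1"
    \<comment> \<open>The cocycle identity for \<open>t = s (inv s t)\<close>, where
      \<open>inv s t\<close> represents the coset \<open>inv s C\<close>.\<close>
    have "d t C = d s C + d (inv\<^bsub>T\<^esub> s \<otimes>\<^bsub>T\<^esub> t) (inv\<^bsub>T\<^esub> s <#\<^bsub>T\<^esub> C)"
      using d_mult[of s "inv\<^bsub>T\<^esub> s \<otimes>\<^bsub>T\<^esub> t" C] that t by (simp flip: T.m_assoc)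
    then show ?thesis
      using that t b[of t] b[of "inv\<^bsub>T\<^esub> s \<otimes>\<^bsub>T\<^esub> t"] by simp
  qed
  let ?a = "\<lambda>C D. if C = D then b C else - F (flip C, \<one>\<^bsub>T\<^esub>) C D / 2"
  have "F (f,s) C D = chi (f C) * chi (f D) * ?a (inv\<^bsub>T\<^esub> s <#\<^bsub>T\<^esub> C) (inv\<^bsub>T\<^esub> s <#\<^bsub>T\<^esub> D) - ?a C D"
    if "(f,s) \<in> carrier G" "C \<in> X" "D \<in> X" for f s C D
  proof (cases "C = D")
    case True
    then show ?thesis using that F_diag[of f s C] diag[of s C] by (simp add: G_carrier)
  next
    case False
    \<comment> \<open>Translation is injective, so off-diagonal positions stay off the diagonal and
      the second branch of \<open>?a\<close> applies at both places.\<close>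
    then have "inv\<^bsub>T\<^esub> s <#\<^bsub>T\<^esub> C \<noteq> inv\<^bsub>T\<^esub> s <#\<^bsub>T\<^esub> D"
      using act_eq_iff[of s C "inv\<^bsub>T\<^esub> s <#\<^bsub>T\<^esub> D"] that by (auto simp: G_carrier)
    then show ?thesis using off_diag[OF that False] False by simp
  qed
  then show ?thesis by (rule that)
qed

text \<open>Taking entries turns a cocycle in \<open>E\<close> into a matrix cocycle; the matrix
  that bounds it lifts back to an endomorphism by \<open>entry_surj\<close>, and
  \<open>E_inject\<close> transfers the identity.\<close>

lemma H1_adjoint_vanishes_V:
  assumes two: "(2::'k::field) \<noteq> 0"
    and hom0: "\<And>h :: 'a \<Rightarrow> 'k. \<lbrakk>\<And>s t. \<lbrakk>s \<in> T1; t \<in> T1\<rbrakk> \<Longrightarrow> h (s \<otimes>\<^bsub>T\<^esub> t) = h s + h t\<rbrakk>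
      \<Longrightarrow> \<forall>t\<in>T1. h t = 0"
  shows "H1_adjoint_vanishes fscale G (V :: (_ \<Rightarrow> 'k) set) rho"
  unfolding H1_adjoint_vanishes_def H1_vanishes_def
proof (intro allI impI, elim conjE)
  let ?conj = "\<lambda>g A. restrict0 V (rho g \<circ> A \<circ> rho (inv\<^bsub>G\<^esub> g))"
  fix c :: "_ \<Rightarrow> (_ \<Rightarrow> 'k) \<Rightarrow> _"
  assume c: "\<forall>g\<in>carrier G. c g \<in> E"
    and cocycle: "\<forall>g\<in>carrier G. \<forall>h\<in>carrier G. c (g \<otimes>\<^bsub>G\<^esub> h) = c g + ?conj g (c h)"
  have *: "entry (c ((f,s) \<otimes>\<^bsub>G\<^esub> (g,t))) C D = entry (c (f,s)) C D
      + chi (f C) * chi (f D) * entry (c (g,t)) (inv\<^bsub>T\<^esub> s <#\<^bsub>T\<^esub> C) (inv\<^bsub>T\<^esub> s <#\<^bsub>T\<^esub> D)"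
    if "(f,s) \<in> carrier G" "(g,t) \<in> carrier G" "C \<in> X" "D \<in> X" for f s g t C D
  proof -
    have "c ((f,s) \<otimes>\<^bsub>G\<^esub> (g,t)) = c (f,s) + ?conj (f,s) (c (g,t))"
      using cocycle that by blast
    moreover have "entry (?conj (f,s) (c (g,t))) C D =
        chi (f C) * chi (f D) * entry (c (g,t)) (inv\<^bsub>T\<^esub> s <#\<^bsub>T\<^esub> C) (inv\<^bsub>T\<^esub> s <#\<^bsub>T\<^esub> D)"
      using that c by (intro entry_conj) auto
    ultimately show ?thesis
      by (simp add: entry_def)
  qed
  obtain a where a: "\<And>f s C D. \<lbrakk>(f,s) \<in> carrier G; C \<in> X; D \<in> X\<rbrakk> \<Longrightarrow> entry (c (f,s)) C D =
      chi (f C) * chi (f D) * a (inv\<^bsub>T\<^esub> s <#\<^bsub>T\<^esub> C) (inv\<^bsub>T\<^esub> s <#\<^bsub>T\<^esub> D) - a C D"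
    using matrix_cocycle_trivial[of "\<lambda>g. entry (c g)", OF two hom0 *] by blast
  obtain A where A: "A \<in> E" "\<And>C D. C \<in> X \<Longrightarrow> D \<in> X \<Longrightarrow> entry A C D = a C D"
    using entry_surj[of a] by blast
  show "\<exists>A\<in>E. \<forall>g\<in>carrier G. c g = ?conj g A - A"
  proof (intro bexI ballI)
    fix g assume g: "g \<in> carrier G"
    obtain f s where fs: "g = (f,s)" by (cases g)
    show "c g = ?conj g A - A"
    proof (rule E_inject)
      show "c g \<in> E" using c g by blast
      show "?conj g A - A \<in> E" by (intro es.subspace_diff subspace_E conj_in_E g A)
      fix C D assume CD: "C \<in> X" "D \<in> X"
      have s: "s \<in> carrier T" using g by (simp add: fs G_carrier)
      have "entry (?conj g A - A) C D = entry (?conj g A) C D - entry A C D"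
        by (simp add: entry_def)
      also have "\<dots> = entry (c g) C D"
        unfolding fs using CD s g a A by (simp add: entry_conj fs)
      finally show "entry (c g) C D = entry (?conj g A - A) C D" ..
    qed
  qed (rule A)
qed

text \<open>With trivial action a cocycle is a homomorphism and every coboundary is zero. The
  homomorphism vanishes on \<open>T\<close> by hypothesis, and on the base group because its
  elements square to \<open>1\<close> while \<open>2 \<noteq> 0\<close>.\<close>

lemma H1_trivial_vanishes_G:
  assumes two: "(2::'k::field) \<noteq> 0"
    and hom0: "\<And>h :: 'a \<Rightarrow> 'k. \<lbrakk>\<And>s t. \<lbrakk>s \<in> carrier T; t \<in> carrier T\<rbrakk> \<Longrightarrow> h (s \<otimes>\<^bsub>T\<^esub> t) = h s + h t\<rbrakk>
      \<Longrightarrow> \<forall>t\<in>carrier T. h t = 0"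
  shows "H1_trivial_vanishes G TYPE('k)"
  unfolding H1_trivial_vanishes_def H1_vanishes_def
proof (intro allI impI, elim conjE)
  fix c :: "_ \<Rightarrow> 'k"
  assume c: "\<forall>g\<in>carrier G. \<forall>h\<in>carrier G. c (g \<otimes>\<^bsub>G\<^esub> h) = c g + c h"
  have "c (one_N, s \<otimes>\<^bsub>T\<^esub> t) = c (one_N, s) + c (one_N, t)" if "s \<in> carrier T" "t \<in> carrier T" for s t
  proof -
    have "(one_N, s) \<otimes>\<^bsub>G\<^esub> (one_N, t) = (one_N, s \<otimes>\<^bsub>T\<^esub> t)"
      using that by (simp add: G_mult one_N_def cong: restrict_cong)
    then show ?thesis
      using c[rule_format, of "(one_N, s)" "(one_N, t)"] that by (simp add: G_carrier)
  qed
  then have c_T: "c (one_N, t) = 0" if "t \<in> carrier T" for t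
    using hom0[of "\<lambda>t. c (one_N, t)"] that by blast
  have "c (f,s) = 0" if "(f,s) \<in> carrier G" for f s
  proof -
    have fs: "f \<in> X \<rightarrow>\<^sub>E carrier L" "s \<in> carrier T" using that by (auto simp: G_carrier)
    have "(\<lambda>C\<in>X. f C) = f" using fs(1) by (rule PiE_restrict)
    then have 1: "(f,\<one>\<^bsub>T\<^esub>) \<otimes>\<^bsub>G\<^esub> (one_N, s) = (f,s)"
      using fs by (simp add: G_mult cong: restrict_cong)
    have "(f,\<one>\<^bsub>T\<^esub>) \<otimes>\<^bsub>G\<^esub> (f,\<one>\<^bsub>T\<^esub>) = (one_N,\<one>\<^bsub>T\<^esub>)"
      using fs by (simp add: G_mult one_N_def L_square cong: restrict_cong)
    then have "2 * c (f,\<one>\<^bsub>T\<^esub>) = 0"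
      using c[rule_format, of "(f,\<one>\<^bsub>T\<^esub>)" "(f,\<one>\<^bsub>T\<^esub>)"] c_T fs by (simp add: G_carrier)
    then show ?thesis
      using 1 c[rule_format, of "(f,\<one>\<^bsub>T\<^esub>)" "(one_N, s)"] c_T two fs by (simp add: G_carrier)
  qed
  then show "\<exists>m\<in>UNIV. \<forall>g\<in>carrier G. c g = m - m" by auto
qed

section \<open>Semisimple elements\<close>

lemma snd_pow: "x \<in> carrier G \<Longrightarrow> snd (x [^]\<^bsub>G\<^esub> (n::nat)) = snd x [^]\<^bsub>T\<^esub> n"
proof (induction n)
  case 0
  then show ?case by (simp add: one_G)
next
  case (Suc n)
  then show ?case by (cases "x [^]\<^bsub>G\<^esub> n"; cases x) (simp add: G_mult)
qed

lemma rho_pow_eigenvector: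
  assumes "g \<in> carrier G" "v \<in> V" "rho g v = fscale c v"
  shows "rho (g [^]\<^bsub>G\<^esub> (n::nat)) v = fscale (c ^ n) v"
proof (induction n)
  case 0
  show ?case using assms by (simp add: rho_one)
next
  case (Suc n)
  have "rho (g [^]\<^bsub>G\<^esub> Suc n) v = rho (g [^]\<^bsub>G\<^esub> n) (rho g v)"
    using assms by (simp add: rho_mult)
  also have "\<dots> = fscale (c ^ Suc n) v"
    using Suc assms by (simp add: rho_scale)
  finally show ?case .
qed

text \<open>Every eigenvalue \<open>c\<close> of \<open>g\<close> has
  \<open>(c ^ n) ^ p = 1\<close>, hence \<open>c ^ n = 1\<close> in characteristic \<open>p\<close>.
  As eigenvectors span \<open>V\<close>, the power \<open>g ^ n\<close> acts as the identity, so its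
  \<open>T\<close>-component fixes all cosets.\<close>

lemma pow_fixes_cosets:
  assumes p: "prime p" "CHAR('k::field) = p"
    and g: "g \<in> carrier G" "g [^]\<^bsub>G\<^esub> (n * p) = \<one>\<^bsub>G\<^esub>"
    and semisimple: "semisimple_on fscale (V :: (_ \<Rightarrow> 'k) set) (rho g)"
    and C: "C \<in> X"
  shows "snd g [^]\<^bsub>T\<^esub> n <#\<^bsub>T\<^esub> C = C"
proof -
  let ?h = "g [^]\<^bsub>G\<^esub> n"
  let ?Fix = "{v \<in> V. rho ?h v = v} :: (_ \<Rightarrow> 'k) set"
  have h: "?h \<in> carrier G" using g by simp
  have "v \<in> ?Fix" if v: "v \<in> V" "v \<noteq> 0" "rho g v = fscale c v" for v :: "_ \<Rightarrow> 'k" and c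
  proof -
    have "fscale (c ^ (n * p)) v = v"
      using rho_pow_eigenvector[OF g(1) v(1,3), of "n * p"] g v by (simp add: rho_one)
    then have "c ^ (n * p) = 1"
      using v(2) fs.scale_right_imp_eq[of v _ 1] by fastforce
    then have "(c ^ n) ^ p = 1" by (simp add: power_mult)
    \<comment> \<open>The additivity of the \<open>p\<close>-th power gives
      \<open>(c ^ n - 1) ^ p = 0\<close>.\<close>
    moreover have "(c ^ n - 1 + 1) ^ p = (c ^ n - 1) ^ p + 1 ^ p"
      by (rule freshmans_dream) (use p in auto)
    ultimately have "c ^ n = 1" by simp
    then show ?thesis
      using rho_pow_eigenvector[OF g(1) v(1,3), of n] v by simp
  qed
  moreover have "fs.subspace ?Fix"
  proof (rule fs.subspaceI)
    show "0 \<in> ?Fix"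
      using fs.subspace_0[OF subspace_V] rho_scale[of ?h 0 0] by auto
    show "x + y \<in> ?Fix" if "x \<in> ?Fix" "y \<in> ?Fix" for x y
      using that rho_linear[OF h, where 'd = 'k] by (auto simp: is_linear_on_def fs.subspace_add)
    show "fscale c x \<in> ?Fix" if "x \<in> ?Fix" for c x
      using that by (auto simp: rho_scale fs.subspace_scale)
  qed
  ultimately have "V \<subseteq> ?Fix"
    using semisimple fs.span_minimal[of "{v \<in> V. v \<noteq> 0 \<and> (\<exists>c. rho g v = fscale c v)}" ?Fix]
    by (fastforce simp: semisimple_on_def)
  then have "e C \<in> ?Fix" using e_in_V by (rule subsetD)
  then have fix_e: "rho ?h (e C) = (e C :: _ \<Rightarrow> 'k)" by simp
  obtain f s where fs: "?h = (f,s)" by (cases ?h)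
  then have s: "s = snd g [^]\<^bsub>T\<^esub> n" using snd_pow[OF g(1), of n] by simp
  have f: "f \<in> X \<rightarrow>\<^sub>E carrier L" and s': "s \<in> carrier T" using h by (auto simp: fs G_carrier)
  \<comment> \<open>The image of \<open>e C\<close> is a signed basis vector at \<open>s C\<close>;
    a nonzero coordinate at \<open>C\<close> forces \<open>s C = C\<close>.\<close>
  have "coord (rho (f,s) (e C)) C = (1::'k)" using fix_e C by (simp add: fs)
  then have "s <#\<^bsub>T\<^esub> C = C"
    using f s' C by (auto simp: rho_e split: if_splits)
  then show ?thesis by (simp add: s)
qed

text \<open>The power with exponent \<open>ord s\<close> lies in the base group, which has exponent
  \<open>2\<close>.\<close>

lemma pow_double_ord:
  assumes "(f,s) \<in> carrier G"
  shows "(f,s) [^]\<^bsub>G\<^esub> (2 * T.ord s) = \<one>\<^bsub>G\<^esub>"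
proof -
  have s: "s \<in> carrier T" using assms by (simp add: G_carrier)
  obtain f' where f': "(f,s) [^]\<^bsub>G\<^esub> T.ord s = (f', \<one>\<^bsub>T\<^esub>)"
    using snd_pow[OF assms, of "T.ord s"] s by (metis T.pow_ord_eq_1 prod.collapse snd_conv)
  have "f' \<in> X \<rightarrow>\<^sub>E carrier L"
    using G.nat_pow_closed[OF assms, of "T.ord s"] by (simp add: f' G_carrier)
  then have "(f', \<one>\<^bsub>T\<^esub>) \<otimes>\<^bsub>G\<^esub> (f', \<one>\<^bsub>T\<^esub>) = \<one>\<^bsub>G\<^esub>"
    by (simp add: G_mult G_one L_square cong: restrict_cong)
  then show ?thesis
    using G.nat_pow_mult[OF assms, of "T.ord s" "T.ord s"] by (simp add: f' mult_2)
qed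

text \<open>If \<open>ord s = p n\<close>, then \<open>(f,s)\<close> to the power
  \<open>2 n p\<close> is \<open>1\<close>, so \<open>s ^ (2 n)\<close> fixes all cosets and is
  \<open>1\<close> by faithfulness. Then \<open>p n\<close> divides \<open>2 n\<close>, which
  contradicts that \<open>p\<close> is odd.\<close>

lemma semisimple_imp_coprime_ord:
  assumes p: "prime p" "odd p" "CHAR('k::field) = p"
    and faithful: "\<And>u. \<lbrakk>u \<in> carrier T; \<forall>C\<in>X. u <#\<^bsub>T\<^esub> C = C\<rbrakk> \<Longrightarrow> u = \<one>\<^bsub>T\<^esub>"
    and g: "(f,s) \<in> carrier G" "semisimple_on fscale (V :: (_ \<Rightarrow> 'k) set) (rho (f,s))"
  shows "coprime (T.ord s) p"
proof (rule ccontr)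
  assume "\<not> coprime (T.ord s) p"
  then have "p dvd T.ord s"
    using p(1) by (metis coprime_commute prime_imp_coprime)
  then obtain n where n: "T.ord s = p * n" by blast
  have s: "s \<in> carrier T" using g by (simp add: G_carrier)
  have "s [^]\<^bsub>T\<^esub> (2 * n) <#\<^bsub>T\<^esub> C = C" if "C \<in> X" for C
    using pow_fixes_cosets[OF p(1,3) g(1) _ g(2) that, of "2 * n"] pow_double_ord[OF g(1)]
    by (simp add: n ac_simps)
  then have "s [^]\<^bsub>T\<^esub> (2 * n) = \<one>\<^bsub>T\<^esub>"
    using faithful[of "s [^]\<^bsub>T\<^esub> (2 * n)"] s by blast
  then have "p * n dvd 2 * n"
    using T.pow_eq_id[OF s] n by simp
  moreover have "n \<noteq> 0"
    using T.ord_ge_1[OF finite_T s] n by auto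
  ultimately have "p dvd 2" by simp
  then show False
    using p by (metis primes_dvd_imp_eq two_is_prime_nat even_numeral)
qed

text \<open>The kernel of the action on cosets is normal, and it is proper because it stabilizes the
  coset \<open>T1\<close>.\<close>

lemma simple_faithful:
  assumes "simple_group T" "T1 \<noteq> carrier T"
    and u: "u \<in> carrier T" "\<forall>C\<in>X. u <#\<^bsub>T\<^esub> C = C"
  shows "u = \<one>\<^bsub>T\<^esub>"
proof -
  interpret simple_group T by fact
  let ?N = "{u \<in> carrier T. \<forall>C\<in>X. u <#\<^bsub>T\<^esub> C = C}"
  have inv: "inv\<^bsub>T\<^esub> x <#\<^bsub>T\<^esub> C = C" if "x \<in> ?N" "C \<in> X" for x C
    using that act_eq_iff[of x C C] by auto
  have "subgroup ?N T"
    by (rule T.subgroupI) (auto simp: inv simp flip: act_act intro!: exI[of _ "\<one>\<^bsub>T\<^esub>"])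
  moreover have "(x \<otimes>\<^bsub>T\<^esub> y \<otimes>\<^bsub>T\<^esub> inv\<^bsub>T\<^esub> x) <#\<^bsub>T\<^esub> C = C"
    if "x \<in> carrier T" "y \<in> ?N" "C \<in> X" for x y C
  proof -
    have "(x \<otimes>\<^bsub>T\<^esub> y \<otimes>\<^bsub>T\<^esub> inv\<^bsub>T\<^esub> x) <#\<^bsub>T\<^esub> C = x <#\<^bsub>T\<^esub> (y <#\<^bsub>T\<^esub> (inv\<^bsub>T\<^esub> x <#\<^bsub>T\<^esub> C))"
      using that by (simp add: T.m_assoc)
    also have "y <#\<^bsub>T\<^esub> (inv\<^bsub>T\<^esub> x <#\<^bsub>T\<^esub> C) = inv\<^bsub>T\<^esub> x <#\<^bsub>T\<^esub> C"
      using that act_closed[of "inv\<^bsub>T\<^esub> x" C] by blast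
    finally show ?thesis using that by simp
  qed
  ultimately have "?N \<lhd> T"
    by (auto simp: T.normal_inv_iff)
  moreover have "?N \<noteq> carrier T"
  proof
    assume N: "?N = carrier T"
    have "t \<in> T1" if "t \<in> carrier T" for t
    proof -
      have "t <#\<^bsub>T\<^esub> T1 = T1" using N that T1_in_X by blast
      then show ?thesis using T.lcos_self[OF that T1] by simp
    qed
    then show False using assms(2) subgroup.subset[OF T1] by blast
  qed
  ultimately have "?N = {\<one>\<^bsub>T\<^esub>}" using no_real_normal_subgroup by blast
  then show ?thesis using u by blast
qed

text \<open>The matrix entry at \<open>(t T1, T1)\<close> is a linear functional that kills every
  semisimple group element but not all of \<open>E\<close>.\<close>

lemma not_spanned_by_semisimple:
  assumes p: "prime p" "odd p" "CHAR('k::field) = p"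
    and simple: "simple_group T"
    and t: "t \<in> carrier T" "\<forall>x\<in>t <#\<^bsub>T\<^esub> T1. \<not> coprime (T.ord x) p"
  shows "\<not> End_spanned_by_semisimple fscale G (V :: (_ \<Rightarrow> 'k) set) rho"
proof
  let ?S = "{restrict0 V (rho g) |g. g \<in> carrier G \<and> semisimple_on fscale (V :: (_ \<Rightarrow> 'k) set) (rho g)}"
  let ?tT1 = "t <#\<^bsub>T\<^esub> T1"
  let ?U = "{A. entry A ?tT1 T1 = (0::'k)}"
  assume span: "End_spanned_by_semisimple fscale G (V :: (_ \<Rightarrow> 'k) set) rho"
  \<comment> \<open>Otherwise the coset of \<open>t\<close> would contain \<open>1\<close>, whose
    order is prime to \<open>p\<close>.\<close>
  have "T1 \<noteq> carrier T"
  proof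
    assume "T1 = carrier T"
    then have "\<one>\<^bsub>T\<^esub> \<in> t <#\<^bsub>T\<^esub> T1" using t by (auto simp: l_coset_def intro!: bexI[of _ "inv\<^bsub>T\<^esub> t"])
    then show False using t(2) by force
  qed
  note faithful = simple_faithful[OF simple this]
  have "?S \<subseteq> ?U"
  proof safe
    fix f s assume g: "(f,s) \<in> carrier G" "semisimple_on fscale (V :: (_ \<Rightarrow> 'k) set) (rho (f,s))"
    then have fs: "f \<in> X \<rightarrow>\<^sub>E carrier L" "s \<in> carrier T" by (auto simp: G_carrier)
    have "coprime (T.ord s) p"
      by (rule semisimple_imp_coprime_ord[OF p faithful g])
    \<comment> \<open>Equality of the cosets would put \<open>s\<close> into \<open>t T1\<close>,
      where no order is prime to \<open>p\<close>.\<close>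
    then have "s <#\<^bsub>T\<^esub> T1 \<noteq> ?tT1"
      using t coset_eq_iff fs by blast
    then show "entry (restrict0 V (rho (f,s))) ?tT1 T1 = (0::'k)"
      using fs t by (auto simp: entry_def restrict0_def rho_e)
  qed
  moreover have "es.subspace ?U"
    by (rule es.subspaceI) (auto simp: entry_def escale_def)
  ultimately have "es.span ?S \<subseteq> ?U" by (rule es.span_minimal)
  then have "E \<subseteq> ?U" using span by (auto simp: End_spanned_by_semisimple_def)
  \<comment> \<open>The all-ones matrix is an endomorphism outside the kernel of the
    functional.\<close>
  moreover obtain A where "A \<in> E" "\<And>C D. C \<in> X \<Longrightarrow> D \<in> X \<Longrightarrow> entry A C D = (1::'k)"
    using entry_surj[of "\<lambda>C D. 1"] by blast
  ultimately show False using t by (metis (mono_tags, lifting) CollectD T1_in_X act_closed subsetD zero_neq_one)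
qed

end

section \<open>Homomorphisms into the additive group of a field\<close>

text \<open>The relation \<open>s s = 1\<close> gives \<open>2 h s = 0\<close>, and conjugating
  \<open>r\<close> to its inverse gives \<open>h r = - h r\<close>; so \<open>h\<close> vanishes on
  the generators.\<close>

lemma hom_to_field_dihedral_zero:
  fixes h :: "'a \<Rightarrow> 'k::field"
  assumes "group T" "dihedral_subgroup T T1 n" "(2::'k) \<noteq> 0"
    and hom: "\<And>s t. \<lbrakk>s \<in> T1; t \<in> T1\<rbrakk> \<Longrightarrow> h (s \<otimes>\<^bsub>T\<^esub> t) = h s + h t"
  shows "\<forall>t\<in>T1. h t = 0"
proof -
  interpret group T by fact
  have T1: "subgroup T1 T" using assms(2) by (simp add: dihedral_subgroup_def)
  interpret T1: subgroup T1 T by fact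
  obtain r s where rs: "r \<in> T1" "s \<in> T1" "ord s = 2"
    "s \<otimes>\<^bsub>T\<^esub> r \<otimes>\<^bsub>T\<^esub> inv\<^bsub>T\<^esub> s = inv\<^bsub>T\<^esub> r" "generate T {r,s} = T1"
    using assms(2) by (auto simp: dihedral_subgroup_def)
  have "h \<one>\<^bsub>T\<^esub> + h \<one>\<^bsub>T\<^esub> = h \<one>\<^bsub>T\<^esub> + 0" using hom[of "\<one>\<^bsub>T\<^esub>" "\<one>\<^bsub>T\<^esub>"] by simp
  then have h_one: "h \<one>\<^bsub>T\<^esub> = 0" by (rule add_left_imp_eq)
  have h_inv: "h (inv\<^bsub>T\<^esub> t) = - h t" if "t \<in> T1" for t
    using hom[of t "inv\<^bsub>T\<^esub> t"] that h_one by (simp add: eq_neg_iff_add_eq_0 add.commute)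
  have "s \<otimes>\<^bsub>T\<^esub> s = \<one>\<^bsub>T\<^esub>"
    using pow_ord_eq_1[of s] rs by (simp add: numeral_2_eq_2)
  then have hs: "h s = 0"
    using hom[of s s] rs h_one assms(3) by simp
  have "h (inv\<^bsub>T\<^esub> r) = h s + h r + h (inv\<^bsub>T\<^esub> s)"
    using rs by (simp flip: rs(4) add: hom)
  then have hr: "h r = 0"
    using h_inv rs hs assms(3) by (simp add: neg_eq_iff_add_eq_0)
  have "h t = 0" if "t \<in> generate T {r,s}" for t
    using that
  proof induction
    case (eng a b)
    then show ?case using hom rs(5) by simp
  qed (use rs h_one hr hs h_inv in auto)
  then show ?thesis using rs(5) by simp
qed

text \<open>The kernel is normal and contains all commutators; the pair \<open>a\<close>,
  \<open>b\<close> shows that it is nontrivial, so it is the whole group.\<close>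

lemma hom_to_field_simple_zero:
  fixes h :: "'a \<Rightarrow> 'k::field"
  assumes "simple_group T" and ab: "a \<in> carrier T" "b \<in> carrier T" "a \<otimes>\<^bsub>T\<^esub> b \<noteq> b \<otimes>\<^bsub>T\<^esub> a"
    and hom: "\<And>s t. \<lbrakk>s \<in> carrier T; t \<in> carrier T\<rbrakk> \<Longrightarrow> h (s \<otimes>\<^bsub>T\<^esub> t) = h s + h t"
  shows "\<forall>t\<in>carrier T. h t = 0"
proof -
  interpret simple_group T by fact
  let ?N = "{t \<in> carrier T. h t = 0}"
  have "h \<one>\<^bsub>T\<^esub> + h \<one>\<^bsub>T\<^esub> = h \<one>\<^bsub>T\<^esub> + 0" using hom[of "\<one>\<^bsub>T\<^esub>" "\<one>\<^bsub>T\<^esub>"] by simp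
  then have h_one: "h \<one>\<^bsub>T\<^esub> = 0" by (rule add_left_imp_eq)
  have h_inv: "h (inv\<^bsub>T\<^esub> t) = - h t" if "t \<in> carrier T" for t
    using hom[of t "inv\<^bsub>T\<^esub> t"] that h_one by (simp add: eq_neg_iff_add_eq_0 add.commute)
  have "subgroup ?N T"
    by (rule subgroupI) (use h_one h_inv hom in auto)
  then have "?N \<lhd> T"
    using h_inv hom by (auto simp: normal_inv_iff)
  then have "?N = carrier T \<or> ?N = {\<one>\<^bsub>T\<^esub>}" by (rule no_real_normal_subgroup)
  moreover have "?N \<noteq> {\<one>\<^bsub>T\<^esub>}"
  proof
    assume N: "?N = {\<one>\<^bsub>T\<^esub>}"
    have "a \<otimes>\<^bsub>T\<^esub> b \<otimes>\<^bsub>T\<^esub> inv\<^bsub>T\<^esub> (b \<otimes>\<^bsub>T\<^esub> a) \<in> ?N"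
      using ab hom h_inv by simp
    then have "a \<otimes>\<^bsub>T\<^esub> b \<otimes>\<^bsub>T\<^esub> inv\<^bsub>T\<^esub> (b \<otimes>\<^bsub>T\<^esub> a) = \<one>\<^bsub>T\<^esub>" using N by blast
    then show False
      using ab by (metis inv_equality inv_inv m_closed inv_closed)
  qed
  ultimately show ?thesis by blast
qed

text \<open>If \<open>r\<close> and \<open>s\<close> commuted, \<open>r\<close> would be its own
  inverse and have order at most \<open>2\<close>. The resulting pair witnesses that the simple
  group is not abelian.\<close>

lemma dihedral_noncommuting:
  assumes "group T" "dihedral_subgroup T T1 n" "n > 2"
  obtains a b where "a \<in> carrier T" "b \<in> carrier T" "a \<otimes>\<^bsub>T\<^esub> b \<noteq> b \<otimes>\<^bsub>T\<^esub> a"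
proof -
  interpret group T by fact
  have T1: "subgroup T1 T" using assms(2) by (simp add: dihedral_subgroup_def)
  obtain r s where rs: "r \<in> carrier T" "s \<in> carrier T" "ord r = n"
    "s \<otimes>\<^bsub>T\<^esub> r \<otimes>\<^bsub>T\<^esub> inv\<^bsub>T\<^esub> s = inv\<^bsub>T\<^esub> r"
    using assms(2) subgroup.mem_carrier[OF T1] by (auto simp: dihedral_subgroup_def)
  have "s \<otimes>\<^bsub>T\<^esub> r \<noteq> r \<otimes>\<^bsub>T\<^esub> s"
  proof
    assume "s \<otimes>\<^bsub>T\<^esub> r = r \<otimes>\<^bsub>T\<^esub> s"
    then have "inv\<^bsub>T\<^esub> r = r" using rs by (simp add: m_assoc)
    then have "r \<otimes>\<^bsub>T\<^esub> r = \<one>\<^bsub>T\<^esub>" using rs by (metis l_inv)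
    then have "r [^]\<^bsub>T\<^esub> (2::nat) = \<one>\<^bsub>T\<^esub>" using rs by (simp add: numeral_2_eq_2)
    then have "n dvd 2" using pow_eq_id rs by blast
    then show False using \<open>n > 2\<close> dvd_imp_le by fastforce
  qed
  then show ?thesis using that rs by blast
qed

section \<open>The index of the dihedral subgroup\<close>

lemma group_SL2: "group (SL2 :: ('f::field \<times> 'f \<times> 'f \<times> 'f) monoid)"
proof (rule groupI)
  fix x y :: "'f \<times> 'f \<times> 'f \<times> 'f"
  assume "x \<in> carrier SL2" "y \<in> carrier SL2"
  moreover obtain a b c d a' b' c' d' where "x = (a,b,c,d)" "y = (a',b',c',d')"
    by (metis surj_pair)
  \<comment> \<open>Multiplicativity of the determinant.\<close>
  moreover have "(a*a' + b*c') * (c*b' + d*d') - (a*b' + b*d') * (c*a' + d*c') =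
      (a*d - b*c) * (a'*d' - b'*c')"
    by (simp add: algebra_simps)
  ultimately show "x \<otimes>\<^bsub>SL2\<^esub> y \<in> carrier SL2"
    by (simp add: SL2_def)
next
  fix x :: "'f \<times> 'f \<times> 'f \<times> 'f"
  assume "x \<in> carrier SL2"
  moreover obtain a b c d where x: "x = (a,b,c,d)"
    by (metis surj_pair)
  ultimately show "\<exists>y\<in>carrier SL2. y \<otimes>\<^bsub>SL2\<^esub> x = \<one>\<^bsub>SL2\<^esub>"
    \<comment> \<open>The adjugate matrix is the inverse for determinant \<open>1\<close>.\<close>
    by (intro bexI[of _ "(d,-b,-c,a)"]) (simp_all add: SL2_def mult.commute)
next
  fix x y w :: "'f \<times> 'f \<times> 'f \<times> 'f"
  show "x \<otimes>\<^bsub>SL2\<^esub> y \<otimes>\<^bsub>SL2\<^esub> w = x \<otimes>\<^bsub>SL2\<^esub> (y \<otimes>\<^bsub>SL2\<^esub> w)"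
    by (cases x; cases y; cases w) (simp add: SL2_def algebra_simps)
qed (auto simp: SL2_def)

lemma subgroup_pm_one: "subgroup {(1,0,0,1), (-1,0,0,-1)} (SL2 :: ('f::field \<times> 'f \<times> 'f \<times> 'f) monoid)"
proof -
  interpret group "SL2 :: ('f \<times> 'f \<times> 'f \<times> 'f) monoid" by (rule group_SL2)
  let ?z = "(-1,0,0,-1) :: 'f \<times> 'f \<times> 'f \<times> 'f"
  have one: "\<one>\<^bsub>SL2\<^esub> = ((1,0,0,1) :: 'f \<times> 'f \<times> 'f \<times> 'f)" by (simp add: SL2_def)
  have z: "?z \<in> carrier SL2" "?z \<otimes>\<^bsub>SL2\<^esub> ?z = \<one>\<^bsub>SL2\<^esub>" by (auto simp: SL2_def)
  then have inv: "inv\<^bsub>SL2\<^esub> ?z = ?z" by (intro inv_equality)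
  have "subgroup {\<one>\<^bsub>SL2\<^esub>, ?z} SL2"
  proof (rule subgroupI)
    show "inv\<^bsub>SL2\<^esub> a \<in> {\<one>\<^bsub>SL2\<^esub>, ?z}" if "a \<in> {\<one>\<^bsub>SL2\<^esub>, ?z}" for a
      using that inv by (metis insertE empty_iff insertI1 insertI2 inv_one)
    show "a \<otimes>\<^bsub>SL2\<^esub> b \<in> {\<one>\<^bsub>SL2\<^esub>, ?z}" if "a \<in> {\<one>\<^bsub>SL2\<^esub>, ?z}" "b \<in> {\<one>\<^bsub>SL2\<^esub>, ?z}" for a b
      using that z r_one[OF z(1)] l_one[OF z(1)] r_one[OF one_closed] by blast
  qed (use z one_closed in blast)+
  then show ?thesis unfolding one .
qed

text \<open>Split by the upper left entry. If \<open>a \<noteq> 0\<close>, then \<open>b\<close> and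
  \<open>c\<close> are free and determine \<open>d\<close>; if \<open>a = 0\<close>, then
  \<open>b \<noteq> 0\<close> determines \<open>c\<close>, and \<open>d\<close> is free.\<close>

lemma card_SL2:
  "card (carrier (SL2 :: ('f::{field,finite} \<times> 'f \<times> 'f \<times> 'f) monoid)) =
    card (UNIV :: 'f set) * (card (UNIV :: 'f set) - 1) * (card (UNIV :: 'f set) + 1)"
proof -
  let ?q = "card (UNIV :: 'f set)"
  let ?U = "UNIV :: 'f set"
  let ?A = "(\<lambda>(a,b,c). (a, b, c, (1 + b*c) / a)) ` ((?U - {0}) \<times> ?U \<times> ?U)"
  let ?B = "(\<lambda>(b,d). (0, b, - 1 / b, d)) ` ((?U - {0}) \<times> ?U)"
  have "carrier (SL2 :: ('f \<times> 'f \<times> 'f \<times> 'f) monoid) = ?A \<union> ?B"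
  proof (rule Set.set_eqI)
    fix x :: "'f \<times> 'f \<times> 'f \<times> 'f"
    obtain a b c d where x: "x = (a,b,c,d)" by (metis surj_pair)
    show "x \<in> carrier SL2 \<longleftrightarrow> x \<in> ?A \<union> ?B"
    proof (cases "a = 0")
      case True
      then have "x \<in> carrier SL2 \<longleftrightarrow> c * b = - 1"
        by (simp add: x SL2_def mult.commute) (metis minus_minus)
      then have "x \<in> carrier SL2 \<longleftrightarrow> b \<noteq> 0 \<and> c = - 1 / b"
        by (metis nonzero_eq_divide_eq mult_zero_right neg_equal_0_iff_equal one_neq_zero)
      then show ?thesis using True by (auto simp: x image_iff)
    next
      case False
      then have "x \<in> carrier SL2 \<longleftrightarrow> d = (1 + b * c) / a"
        by (auto simp: x SL2_def field_simps)
      then show ?thesis using False by (auto simp: x image_iff)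
    qed
  qed
  moreover have "card ?A = (?q - 1) * (?q * ?q)"
    by (subst card_image) (auto simp: inj_on_def card_cartesian_product card_Diff_singleton simp del: UNIV_Times_UNIV)
  moreover have "card ?B = (?q - 1) * ?q"
    by (subst card_image) (auto simp: inj_on_def card_cartesian_product card_Diff_singleton)
  moreover have "?A \<inter> ?B = {}" by auto
  ultimately have "card (carrier (SL2 :: ('f \<times> 'f \<times> 'f \<times> 'f) monoid)) =
      (?q - 1) * (?q * ?q) + (?q - 1) * ?q"
    by (simp add: card_Un_disjoint)
  also have "\<dots> = ?q * (?q - 1) * (?q + 1)"
    by (simp add: algebra_simps)
  finally show ?thesis .
qed

text \<open>Lagrange's theorem for the subgroup of \<open>1\<close> and \<open>-1\<close>. Stating
  divisibility avoids deciding whether it has one or two elements, which depends on the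
  characteristic of the matrix field.\<close>

lemma order_PSL2_dvd:
  "card (carrier (PSL2 :: ('f::{field,finite} \<times> 'f \<times> 'f \<times> 'f) set monoid)) dvd
    card (UNIV :: 'f set) * (card (UNIV :: 'f set) - 1) * (card (UNIV :: 'f set) + 1)"
proof -
  let ?Z = "{(1,0,0,1), (-1,0,0,-1)} :: ('f \<times> 'f \<times> 'f \<times> 'f) set"
  have "card (rcosets\<^bsub>SL2\<^esub> ?Z) * card ?Z = card (carrier (SL2 :: ('f \<times> 'f \<times> 'f \<times> 'f) monoid))"
    using group.lagrange[OF group_SL2 subgroup_pm_one] by (simp only: Coset.order_def)
  moreover have "carrier PSL2 = rcosets\<^bsub>SL2\<^esub> ?Z"
    by (simp add: PSL2_def FactGroup_def)
  ultimately show ?thesis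
    unfolding card_SL2 by (metis dvd_triv_left)
qed

text \<open>If \<open>p\<close> divided the index, its square would divide the group order and hence
  \<open>q (q - 1) (q + 1)\<close>. As \<open>p\<close> is odd and divides \<open>q - 1\<close>, it
  is prime to \<open>q\<close> and to \<open>q + 1\<close>, so its square would divide
  \<open>q - 1\<close>.\<close>

lemma index_coprime:
  assumes p: "prime p" "odd p" "p dvd card (UNIV :: 'f::{field,finite} set) - 1" "\<not> p\<^sup>2 dvd card (UNIV :: 'f set) - 1"
    and T: "group (PSL2 :: ('f \<times> 'f \<times> 'f \<times> 'f) set monoid)"
    and T1: "dihedral_subgroup (PSL2 :: ('f \<times> 'f \<times> 'f \<times> 'f) set monoid) T1 p"
  shows "coprime (card (lcosets_of PSL2 T1)) p"
proof (rule ccontr)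
  interpret group "PSL2 :: ('f \<times> 'f \<times> 'f \<times> 'f) set monoid" by fact
  let ?q = "card (UNIV :: 'f set)"
  assume "\<not> coprime (card (lcosets_of PSL2 T1)) p"
  then have "p dvd card (lcosets_of PSL2 T1)"
    using p(1) by (metis coprime_commute prime_imp_coprime)
  then obtain k where k: "card (lcosets_of PSL2 T1) = p * k" ..
  have "lcosets\<^bsub>PSL2\<^esub> T1 = lcosets_of PSL2 T1"
    by (auto simp: LCOSETS_def lcosets_of_def)
  then have "card (lcosets_of PSL2 T1) * (2 * p) = card (carrier (PSL2 :: ('f \<times> 'f \<times> 'f \<times> 'f) set monoid))"
    using l_lagrange[of T1] T1 by (simp add: dihedral_subgroup_def Coset.order_def)
  then have "card (carrier (PSL2 :: ('f \<times> 'f \<times> 'f \<times> 'f) set monoid)) = p\<^sup>2 * (2 * k)"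
    by (simp add: k power2_eq_square ac_simps)
  then have "p\<^sup>2 dvd card (carrier (PSL2 :: ('f \<times> 'f \<times> 'f \<times> 'f) set monoid))"
    by simp
  then have "p\<^sup>2 dvd ?q * (?q - 1) * (?q + 1)"
    using order_PSL2_dvd[where 'f = 'f] by (rule dvd_trans)
  moreover have q: "?q = (?q - 1) + 1"
    \<comment> \<open>Subtraction of naturals is truncated, so positivity of \<open>q\<close> is
      required.\<close>
    using finite_UNIV_card_ge_0[where 'a = 'f] by simp
  have "\<not> p dvd ?q"
  proof
    assume "p dvd ?q"
    then have "p dvd 1" using p(3) q by (metis dvd_add_right_iff)
    then show False using p(1) by simp
  qed
  moreover have "\<not> p dvd ?q + 1"
  proof
    assume "p dvd ?q + 1"
    then have "p dvd (?q - 1) + 2" using q by simp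
    then have "p dvd 2" using p(3) by (simp only: dvd_add_right_iff)
    then show False
      using p(1,2) by (metis primes_dvd_imp_eq two_is_prime_nat even_numeral)
  qed
  ultimately have "p\<^sup>2 dvd ?q * (?q - 1) * (?q + 1)" "coprime (p\<^sup>2) ?q" "coprime (p\<^sup>2) (?q + 1)"
    using p(1) prime_imp_coprime by (auto simp only: coprime_power_left_iff)
  then have "p\<^sup>2 dvd ?q - 1"
    by (simp only: coprime_dvd_mult_left_iff coprime_dvd_mult_right_iff)
  then show False using p(4) by simp
qed

text \<open>Over the algebraically closed field \<open>'k\<close>, irreducibility of the
  finite-dimensional \<open>V\<close> amounts to absolute irreducibility.\<close>

theorem theorem5p4:
  fixes p :: nat
    and T1 :: "('f::{field,finite} \<times> 'f \<times> 'f \<times> 'f) set set"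
    and L :: "'l monoid"
  assumes "prime p" and "odd p"
    and "CHAR('k::alg_closed_field) = p"
    and "p dvd (card (UNIV :: 'f set) - 1)" and "\<not> p^2 dvd (card (UNIV :: 'f set) - 1)"
    and "simple_group (PSL2 :: ('f \<times> 'f \<times> 'f \<times> 'f) set monoid)"
    and "dihedral_subgroup PSL2 T1 p"
    and "\<exists>t\<in>carrier PSL2. \<forall>x\<in>t <#\<^bsub>PSL2\<^esub> T1. \<not> coprime (group.ord PSL2 x) p"
    and "group L" and "cyclic_group L" and "card (carrier L) = 2"
  defines "G \<equiv> wreath L PSL2 T1"
    and "m \<equiv> card (lcosets_of PSL2 T1)"
    and "V \<equiv> induced_space (wreath L PSL2 T1) (wreath_K L PSL2 T1) (W_char L T1 :: _ \<Rightarrow> 'k)"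
    and "\<rho> \<equiv> induced_action (wreath L PSL2 T1)"
  shows "is_rep fscale G V \<rho> \<and> irreducible_rep fscale G V \<rho>
         \<and> vector_space.dim fscale V = m \<and> coprime m p
         \<and> H1_trivial_vanishes G TYPE('k) \<and> \<not> p dvd vector_space.dim fscale V
         \<and> H1_adjoint_vanishes fscale G V \<rho>
         \<and> \<not> adequate p fscale G V \<rho>
         \<and> \<not> End_spanned_by_semisimple fscale G V \<rho>"
proof -
  interpret T: simple_group "PSL2 :: ('f \<times> 'f \<times> 'f \<times> 'f) set monoid" by fact
  have T1: "subgroup T1 PSL2"
    using assms(7) by (simp add: dihedral_subgroup_def)
  interpret wreath_sign PSL2 L T1
    using T.is_group \<open>group L\<close> T1 assms(11) by (simp add: wreath_sign_def wreath_sign_axioms_def)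
  \<comment> \<open>Oddness of \<open>p\<close> becomes \<open>2 \<noteq> 0\<close> in the field,
    the form in which the sign and cohomology arguments use it.\<close>
  have "\<not> p dvd 2"
    using assms(1,2) by (metis primes_dvd_imp_eq two_is_prime_nat even_numeral)
  then have two: "(2::'k) \<noteq> 0"
    using of_nat_eq_0_iff_char_dvd[where 'a = 'k, of 2] assms(3) by simp
  have "p > 2"
    using prime_gt_1_nat[OF assms(1)] assms(2) by (cases "p = 2") auto
  then obtain a b :: "('f \<times> 'f \<times> 'f \<times> 'f) set" where ab:
    "a \<in> carrier PSL2" "b \<in> carrier PSL2" "a \<otimes>\<^bsub>PSL2\<^esub> b \<noteq> b \<otimes>\<^bsub>PSL2\<^esub> a"
    using dihedral_noncommuting[OF T.is_group assms(7)] by blast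
  obtain t where t: "t \<in> carrier PSL2" "\<forall>x\<in>t <#\<^bsub>PSL2\<^esub> T1. \<not> coprime (group.ord PSL2 x) p"
    using assms(8) by blast
  have dim: "vector_space.dim fscale V = m"
    unfolding V_def m_def by (rule dim_V)
  have m: "coprime m p"
    unfolding m_def by (rule index_coprime[OF assms(1,2,4,5) T.is_group assms(7)])
  then have "\<not> p dvd m"
    using prime_gt_1_nat[OF assms(1)] by (metis coprime_commute coprime_absorb_left nat_neq_iff nat_dvd_1_iff_1)
  moreover have "\<not> End_spanned_by_semisimple fscale G V \<rho>"
    unfolding G_def V_def \<rho>_def
    by (rule not_spanned_by_semisimple[OF assms(1,2,3,6) t])
  moreover have "H1_trivial_vanishes G TYPE('k)"
    unfolding G_def
    by (rule H1_trivial_vanishes_G[OF two]) (rule hom_to_field_simple_zero[OF assms(6) ab])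
  moreover have "H1_adjoint_vanishes fscale G V \<rho>"
    unfolding G_def V_def \<rho>_def
    by (rule H1_adjoint_vanishes_V[OF two]) (rule hom_to_field_dihedral_zero[OF T.is_group assms(7) two])
  moreover have "is_rep fscale G V \<rho>"
    unfolding G_def V_def \<rho>_def by (rule is_rep_V)
  moreover have "irreducible_rep fscale G V \<rho>"
    unfolding G_def V_def \<rho>_def by (rule irreducible_V[OF two])
  ultimately show ?thesis
    using dim m by (simp add: adequate_def)
qed

end
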